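(* For every $n\in\mathbb{N}$, the partitioned graph $\mathcal{L}_n$ is pre-Lorentzian.
   Context: All graphs are finite, simple and undirected. $\mathbb{N}$ includes $0$. Coloured and partitioned graphs. A coloured graph is a pair $(G,i)$ with $G$ a graph and $i$ a map from $V(G)$ to a set of colours (not required to be a proper colouring). A vertex, and its colour, is free if no other vertex has the same colour. A partitioned graph is a coloured graph with a distinguished colour, the bound colour, such that every colour other than the bound colour is free; vertices of the bound colour are called bound. The graph $\mathcal{L}_n$. It is the partitioned graph on $3n+1$ vertices $c$, $\ell_1,\dots,\ell_n$, $a_1,\dots,a_n$, $b_1,\dots,b_n$ with edges $c\ell_i$, $ca_i$ and $a_ib_i$ for $1\le i\le n$. The vertices $a_1,\dots,a_n$ are free (each has its own colour), and all other vertices are bound. The vertex $c$ is called the centre. For $n=0$ this is a single bound vertex. Coloured independence polynomial. For a coloured graph $\mathcal{G}=(G,i)$, $\mathrm{C}(\mathcal{G})=\sum_{S}\prod_{v\in S}x_{i(v)}$, the sum being over all independent sets $S\subseteq V(G)$ (sets containing no two adjacent vertices). Homogenisation. For a polynomial $p$ in $x_1,\dots,x_n$, $\mathrm{H}(p)$ is the homogeneous polynomial in $x_1,\dots,x_n,y$ of minimal degree with $\mathrm{H}(p)|_{y=1}=p$; $y$ is the homogenising variable. Lorentzian polynomials. A finite set $A\subset\mathbb{Z}^n$ is M-convex if for all $\alpha,\beta\in A$ and every index $i$ with $\alpha_i>\beta_i$ there is an index $j$ with $\beta_j>\alpha_j$ and $\alpha-e_i+e_j\in A$, where $e_i$ is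 the $i$th standard basis vector. The support of $p=\sum_\alpha c_\alpha x^\alpha$ is $\{\alpha: c_\alpha\neq0\}$. A homogeneous real polynomial $p$ of degree $d$ with non-negative coefficients is Lorentzian if its support is M-convex and, for every partial derivative of $p$ of order $d-2$, the corresponding Hessian matrix has at most one positive eigenvalue. Pre-Lorentzian. A partitioned graph $\mathcal{G}$ is pre-Lorentzian if there exists $k\in\mathbb{N}$ such that $(xy)^k\cdot\mathrm{H}(\mathrm{C}(\mathcal{G}))$ is Lorentzian, where $x$ is the variable of the bound colour and $y$ is the homogenising variable. *)

theory Defs
  imports "HOL-Library.Poly_Mapping" "Jordan_Normal_Form.Char_Poly"
begin

section \<open>Real polynomials in several variables\<close>

text \<open>A monomial is a finitely supported exponent vector and a polynomial a finitely supported
  coefficient function on monomials; the ring structure is the one of \<^theory>\<open>HOL-Library.Poly_Mapping\<close>.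
  The type of variables may be infinite; where the ambient finite set of variables
  matters, it is an explicit parameter.\<close>

type_synonym 'v mpoly = "('v \<Rightarrow>\<^sub>0 nat) \<Rightarrow>\<^sub>0 real"

definition var :: "'v \<Rightarrow> 'v mpoly" where
  "var v = Poly_Mapping.single (Poly_Mapping.single v 1) 1"

definition monom_degree :: "('v \<Rightarrow>\<^sub>0 nat) \<Rightarrow> nat" where
  "monom_degree m = (\<Sum>v\<in>Poly_Mapping.keys m. Poly_Mapping.lookup m v)"

definition homogeneous :: "nat \<Rightarrow> 'v mpoly \<Rightarrow> bool" where
  "homogeneous d p \<longleftrightarrow> (\<forall>m\<in>Poly_Mapping.keys p. monom_degree m = d)"

definition substitute :: "('v \<Rightarrow> 'w mpoly) \<Rightarrow> 'v mpoly \<Rightarrow> 'w mpoly" where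
  "substitute f p = (\<Sum>m\<in>Poly_Mapping.keys p.
     Poly_Mapping.single 0 (Poly_Mapping.lookup p m) *
     (\<Prod>v\<in>Poly_Mapping.keys m. f v ^ Poly_Mapping.lookup m v))"

text \<open>The subtraction of exponents is truncated, but where it truncates the coefficient is 0.\<close>

definition partial_deriv :: "'v \<Rightarrow> 'v mpoly \<Rightarrow> 'v mpoly" where
  "partial_deriv v p = (\<Sum>m\<in>Poly_Mapping.keys p.
     Poly_Mapping.single (m - Poly_Mapping.single v 1)
       (real (Poly_Mapping.lookup m v) * Poly_Mapping.lookup p m))"

definition support :: "'v mpoly \<Rightarrow> ('v \<Rightarrow> int) set" where
  "support p = (\<lambda>m v. int (Poly_Mapping.lookup m v)) ` Poly_Mapping.keys p"


section \<open>Homogenisation\<close>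

datatype 'v hvar = Orig 'v | Homog

definition dehomogenise :: "'v hvar mpoly \<Rightarrow> 'v mpoly" where
  "dehomogenise = substitute (\<lambda>w. case w of Orig v \<Rightarrow> var v | Homog \<Rightarrow> 1)"

definition is_homogenisation :: "'v mpoly \<Rightarrow> 'v hvar mpoly \<Rightarrow> bool" where
  "is_homogenisation p q \<longleftrightarrow>
     (\<exists>d. homogeneous d q \<and> dehomogenise q = p \<and>
          (\<forall>d' q'. homogeneous d' q' \<and> dehomogenise q' = p \<longrightarrow> d \<le> d'))"

definition homogenise :: "'v mpoly \<Rightarrow> 'v hvar mpoly" where
  "homogenise p = (THE q. is_homogenisation p q)"


section \<open>Lorentzian polynomials\<close>

text \<open>Here \<open>W\<close> is the finite set indexing the coordinates.\<close>

definition M_convex :: "'v set \<Rightarrow> ('v \<Rightarrow> int) set \<Rightarrow> bool" where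
  "M_convex W A \<longleftrightarrow> finite A \<and>
     (\<forall>\<alpha>\<in>A. \<forall>\<beta>\<in>A. \<forall>i\<in>W. \<alpha> i > \<beta> i \<longrightarrow>
        (\<exists>j\<in>W. \<beta> j > \<alpha> j \<and> (\<lambda>v. \<alpha> v - of_bool (v = i) + of_bool (v = j)) \<in> A))"

text \<open>Eigenvalues are counted with their algebraic multiplicity.\<close>

definition at_most_one_positive_eigenvalue :: "real mat \<Rightarrow> bool" where
  "at_most_one_positive_eigenvalue M \<longleftrightarrow> size {#r \<in># proots (char_poly M). r > 0#} \<le> 1"

text \<open>The Hessian of a quadratic form \<open>q\<close>, whose second partial derivatives are constants,
  with rows and columns ordered as in the list \<open>vs\<close>.\<close>

definition hessian :: "'v list \<Rightarrow> 'v mpoly \<Rightarrow> real mat" where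
  "hessian vs q = mat (length vs) (length vs)
     (\<lambda>(i, j). Poly_Mapping.lookup (partial_deriv (vs ! i) (partial_deriv (vs ! j) q)) 0)"

text \<open>\<open>W\<close> is the set of variables of the ambient polynomial ring and \<open>vs\<close> ranges over its
  enumerations (the eigenvalues do not depend on the enumeration). The list \<open>us\<close> gives the
  variables of a partial derivative of order \<open>d - 2\<close>; there is none if \<open>d < 2\<close>.\<close>

definition lorentzian :: "'v set \<Rightarrow> 'v mpoly \<Rightarrow> bool" where
  "lorentzian W p \<longleftrightarrow> finite W \<and> (\<forall>m\<in>Poly_Mapping.keys p. Poly_Mapping.keys m \<subseteq> W) \<and>
     (\<exists>d. homogeneous d p \<and>
        (\<forall>m. Poly_Mapping.lookup p m \<ge> 0) \<and>
        M_convex W (support p) \<and>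
        (\<forall>us vs. set us \<subseteq> W \<and> length us + 2 = d \<and> set vs = W \<and> distinct vs \<longrightarrow>
           at_most_one_positive_eigenvalue (hessian vs (fold partial_deriv us p))))"


section \<open>Coloured and partitioned graphs\<close>

record ('v, 'c) coloured_graph =
  verts :: "'v set"
  edges :: "'v set set"
  colour :: "'v \<Rightarrow> 'c"

record ('v, 'c) partitioned_graph = "('v, 'c) coloured_graph" +
  bound_colour :: 'c

definition is_coloured_graph :: "('v, 'c, 'z) coloured_graph_scheme \<Rightarrow> bool" where
  "is_coloured_graph G \<longleftrightarrow> finite (verts G) \<and>
     (\<forall>e\<in>edges G. \<exists>u\<in>verts G. \<exists>v\<in>verts G. u \<noteq> v \<and> e = {u, v})"

definition free_vertex :: "('v, 'c, 'z) coloured_graph_scheme \<Rightarrow> 'v \<Rightarrow> bool" where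
  "free_vertex G v \<longleftrightarrow> v \<in> verts G \<and> (\<forall>u\<in>verts G. u \<noteq> v \<longrightarrow> colour G u \<noteq> colour G v)"

definition is_partitioned_graph :: "('v, 'c) partitioned_graph \<Rightarrow> bool" where
  "is_partitioned_graph G \<longleftrightarrow> is_coloured_graph G \<and>
     (\<forall>v\<in>verts G. colour G v \<noteq> bound_colour G \<longrightarrow> free_vertex G v)"

definition independent_set :: "('v, 'c, 'z) coloured_graph_scheme \<Rightarrow> 'v set \<Rightarrow> bool" where
  "independent_set G S \<longleftrightarrow> S \<subseteq> verts G \<and> (\<forall>u\<in>S. \<forall>v\<in>S. {u, v} \<notin> edges G)"

definition coloured_independence_poly :: "('v, 'c, 'z) coloured_graph_scheme \<Rightarrow> 'c mpoly" where
  "coloured_independence_poly G = (\<Sum>S | independent_set G S. \<Prod>v\<in>S. var (colour G v))"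

text \<open>The ambient variables are those of the colours in use, that of the bound colour (even if
  there is no bound vertex) and the homogenising variable.\<close>

definition pre_lorentzian :: "('v, 'c) partitioned_graph \<Rightarrow> bool" where
  "pre_lorentzian G \<longleftrightarrow> is_partitioned_graph G \<and>
     (\<exists>k::nat. lorentzian (insert Homog (Orig ` insert (bound_colour G) (colour G ` verts G)))
        ((var (Orig (bound_colour G)) * var Homog) ^ k * homogenise (coloured_independence_poly G)))"


section \<open>The graphs \<open>\<L>\<^sub>n\<close>\<close>

datatype L_vertex = Centre | Leaf nat | A_vertex nat | B_vertex nat

datatype L_colour = Bound | Free nat

fun L_col :: "L_vertex \<Rightarrow> L_colour" where
  "L_col (A_vertex i) = Free i"
| "L_col _ = Bound"

definition L_graph :: "nat \<Rightarrow> (L_vertex, L_colour) partitioned_graph" where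
  "L_graph n = \<lparr>
     verts = {Centre} \<union> Leaf ` {1..n} \<union> A_vertex ` {1..n} \<union> B_vertex ` {1..n},
     edges = (\<Union>i\<in>{1..n}. {{Centre, Leaf i}, {Centre, A_vertex i}, {A_vertex i, B_vertex i}}),
     colour = L_col,
     bound_colour = Bound\<rparr>"

lemma is_partitioned_graph_L_graph: "is_partitioned_graph (L_graph n)"
proof -
  have "is_coloured_graph (L_graph n)"
    unfolding is_coloured_graph_def
  proof (intro conjI ballI)
    fix e assume "e \<in> edges (L_graph n)"
    then obtain i where i: "i \<in> {1..n}"
      and e: "e = {Centre, Leaf i} \<or> e = {Centre, A_vertex i} \<or> e = {A_vertex i, B_vertex i}"
      by (auto simp: L_graph_def)
    have "Centre \<in> verts (L_graph n)" "Leaf i \<in> verts (L_graph n)"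
      "A_vertex i \<in> verts (L_graph n)" "B_vertex i \<in> verts (L_graph n)"
      using i by (simp_all add: L_graph_def)
    with e show "\<exists>u\<in>verts (L_graph n). \<exists>v\<in>verts (L_graph n). u \<noteq> v \<and> e = {u, v}"
      by (metis L_vertex.distinct(1,3,11))
  qed (simp add: L_graph_def)
  moreover have "free_vertex (L_graph n) v"
    if "v \<in> verts (L_graph n)" "colour (L_graph n) v \<noteq> bound_colour (L_graph n)" for v
    using that unfolding free_vertex_def L_graph_def by auto
  ultimately show ?thesis
    by (simp add: is_partitioned_graph_def)
qed


section \<open>Homogenisations exist and are unique\<close>

lemma prod_keys_superset:
  assumes "finite K" "Poly_Mapping.keys m \<subseteq> K"
  shows "(\<Prod>v\<in>Poly_Mapping.keys m. (f v :: 'a mpoly) ^ Poly_Mapping.lookup m v) =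
         (\<Prod>v\<in>K. f v ^ Poly_Mapping.lookup m v)"
  using assms by (intro prod.mono_neutral_left) (auto simp: in_keys_iff)

lemma var_power: "var v ^ n = Poly_Mapping.single (Poly_Mapping.single v n) 1"
  by (induction n) (simp_all add: var_def mult_single flip: single_add)

lemma inj_Orig: "inj Orig"
  by (simp add: inj_def)

lemma prod_single: "finite K \<Longrightarrow>
    (\<Prod>v\<in>K. Poly_Mapping.single (g v) (1::real)) = Poly_Mapping.single (\<Sum>v\<in>K. g v) 1"
  by (induction K rule: finite_induct) (simp_all add: mult_single)

lemma sum_single_lookup:
  "(\<Sum>v\<in>Poly_Mapping.keys m. Poly_Mapping.single v (Poly_Mapping.lookup m v)) = m"
  by (rule poly_mapping_eqI)
    (auto simp: lookup_sum lookup_single when_def sum.delta' in_keys_iff)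

lemma dehomogenise_monom:
  "(\<Prod>v\<in>Poly_Mapping.keys m. (case v of Orig v \<Rightarrow> var v | Homog \<Rightarrow> 1) ^ Poly_Mapping.lookup m v)
     = Poly_Mapping.single (Poly_Mapping.map_key Orig m) 1"
proof -
  let ?m = "Poly_Mapping.map_key Orig m"
  have look: "Poly_Mapping.lookup ?m v = Poly_Mapping.lookup m (Orig v)" for v
    by (simp add: map_key.rep_eq inj_Orig)
  have keys: "Poly_Mapping.keys m \<subseteq> insert Homog (Orig ` Poly_Mapping.keys ?m)"
  proof
    fix w assume "w \<in> Poly_Mapping.keys m"
    then show "w \<in> insert Homog (Orig ` Poly_Mapping.keys ?m)"
      by (cases w) (auto simp: in_keys_iff look)
  qed
  have "(\<Prod>v\<in>Poly_Mapping.keys m. (case v of Orig v \<Rightarrow> var v | Homog \<Rightarrow> 1) ^ Poly_Mapping.lookup m v)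
     = (\<Prod>v\<in>insert Homog (Orig ` Poly_Mapping.keys ?m).
          (case v of Orig v \<Rightarrow> var v | Homog \<Rightarrow> 1) ^ Poly_Mapping.lookup m v)"
    by (rule prod_keys_superset) (use keys in auto)
  also have "\<dots> = (\<Prod>v\<in>Poly_Mapping.keys ?m. var v ^ Poly_Mapping.lookup ?m v)"
    by (subst prod.insert) (auto simp: prod.reindex inj_on_def look)
  also have "\<dots> = Poly_Mapping.single ?m 1"
    by (simp add: var_power prod_single sum_single_lookup)
  finally show ?thesis .
qed

lemma dehomogenise_eq:
  "dehomogenise q = (\<Sum>m\<in>Poly_Mapping.keys q.
     Poly_Mapping.single (Poly_Mapping.map_key Orig m) (Poly_Mapping.lookup q m))"
  by (simp add: dehomogenise_def substitute_def dehomogenise_monom mult_single)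

lemma monom_degree_superset:
  assumes "finite K" "Poly_Mapping.keys m \<subseteq> K"
  shows "monom_degree m = (\<Sum>v\<in>K. Poly_Mapping.lookup m v)"
  unfolding monom_degree_def using assms
  by (intro sum.mono_neutral_left) (auto simp: in_keys_iff)

lemma monom_degree_hvar:
  "monom_degree m = monom_degree (Poly_Mapping.map_key Orig m) + Poly_Mapping.lookup m Homog"
proof -
  let ?m = "Poly_Mapping.map_key Orig m"
  have look: "Poly_Mapping.lookup ?m v = Poly_Mapping.lookup m (Orig v)" for v
    by (simp add: map_key.rep_eq inj_Orig)
  have keys: "Poly_Mapping.keys m \<subseteq> insert Homog (Orig ` Poly_Mapping.keys ?m)"
  proof
    fix w assume "w \<in> Poly_Mapping.keys m"
    then show "w \<in> insert Homog (Orig ` Poly_Mapping.keys ?m)"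
      by (cases w) (auto simp: in_keys_iff look)
  qed
  have "monom_degree m = (\<Sum>v\<in>insert Homog (Orig ` Poly_Mapping.keys ?m). Poly_Mapping.lookup m v)"
    by (rule monom_degree_superset) (use keys in auto)
  also have "\<dots> = Poly_Mapping.lookup m Homog + monom_degree ?m"
    unfolding monom_degree_def by (subst sum.insert) (auto simp: sum.reindex inj_on_def look)
  finally show ?thesis by simp
qed

lemma homogeneous_monom_inj:
  assumes "Poly_Mapping.map_key Orig m = Poly_Mapping.map_key Orig m'"
    and "monom_degree m = monom_degree m'"
  shows "m = m'"
proof (rule poly_mapping_eqI)
  fix w
  show "Poly_Mapping.lookup m w = Poly_Mapping.lookup m' w"
  proof (cases w)
    case (Orig v)
    have "Poly_Mapping.lookup (Poly_Mapping.map_key Orig m) v =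
          Poly_Mapping.lookup (Poly_Mapping.map_key Orig m') v"
      by (simp add: assms(1))
    with Orig show ?thesis by (simp add: map_key.rep_eq inj_Orig)
  next
    case Homog
    with assms monom_degree_hvar[of m] monom_degree_hvar[of m'] show ?thesis by simp
  qed
qed

lemma lookup_dehomogenise:
  assumes "homogeneous d q" "monom_degree m = d"
  shows "Poly_Mapping.lookup (dehomogenise q) (Poly_Mapping.map_key Orig m) = Poly_Mapping.lookup q m"
proof -
  have "Poly_Mapping.lookup (dehomogenise q) (Poly_Mapping.map_key Orig m) =
     (\<Sum>m'\<in>Poly_Mapping.keys q. Poly_Mapping.lookup q m' when
        Poly_Mapping.map_key Orig m' = Poly_Mapping.map_key Orig m)"
    by (simp add: dehomogenise_eq lookup_sum lookup_single)
  also have "\<dots> = (\<Sum>m'\<in>Poly_Mapping.keys q. Poly_Mapping.lookup q m' when m' = m)"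
    using assms homogeneous_monom_inj
    by (intro sum.cong refl) (auto simp: homogeneous_def when_def)
  also have "\<dots> = Poly_Mapping.lookup q m"
    by (auto simp: when_def sum.delta in_keys_iff)
  finally show ?thesis .
qed

lemma dehomogenise_inj:
  assumes "homogeneous d q" "homogeneous d q'" "dehomogenise q = dehomogenise q'"
  shows "q = q'"
proof (rule poly_mapping_eqI)
  fix m
  show "Poly_Mapping.lookup q m = Poly_Mapping.lookup q' m"
  proof (cases "monom_degree m = d")
    case True
    with assms show ?thesis by (metis lookup_dehomogenise)
  next
    case False
    with assms show ?thesis
      by (metis homogeneous_def not_in_keys_iff_lookup_eq_zero)
  qed
qed

lemma homogeneous_lift_exists: "\<exists>d q. homogeneous d q \<and> dehomogenise q = p"
proof -
  define d where "d = (\<Sum>m\<in>Poly_Mapping.keys p. monom_degree m)"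
  have le: "monom_degree m \<le> d" if "m \<in> Poly_Mapping.keys p" for m
    unfolding d_def using that by (simp add: member_le_sum)
  define h :: "('a \<Rightarrow>\<^sub>0 nat) \<Rightarrow> ('a hvar \<Rightarrow>\<^sub>0 nat)" where
    "h m = (\<Sum>v\<in>Poly_Mapping.keys m. Poly_Mapping.single (Orig v) (Poly_Mapping.lookup m v))
            + Poly_Mapping.single Homog (d - monom_degree m)" for m
  have hO: "Poly_Mapping.lookup (h m) (Orig v) = Poly_Mapping.lookup m v" for m v
    by (auto simp: h_def lookup_add lookup_sum lookup_single when_def sum.delta in_keys_iff)
  have hH: "Poly_Mapping.lookup (h m) Homog = d - monom_degree m" for m
    by (simp add: h_def lookup_add lookup_sum lookup_single when_def)
  have mk: "Poly_Mapping.map_key Orig (h m) = m" for m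
    by (rule poly_mapping_eqI) (simp add: map_key.rep_eq inj_Orig hO)
  have inj: "inj h"
    by (metis injI mk)
  define q where "q = (\<Sum>m\<in>Poly_Mapping.keys p. Poly_Mapping.single (h m) (Poly_Mapping.lookup p m))"
  have look: "Poly_Mapping.lookup q (h m) = Poly_Mapping.lookup p m" for m
    using inj by (auto simp: q_def lookup_sum lookup_single when_def inj_eq sum.delta in_keys_iff)
  have keys: "Poly_Mapping.keys q = h ` Poly_Mapping.keys p"
  proof
    show "Poly_Mapping.keys q \<subseteq> h ` Poly_Mapping.keys p"
    proof
      fix w assume "w \<in> Poly_Mapping.keys q"
      then have "(\<Sum>m\<in>Poly_Mapping.keys p. Poly_Mapping.lookup p m when h m = w) \<noteq> 0"
        by (simp add: in_keys_iff q_def lookup_sum lookup_single)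
      then obtain m where "m \<in> Poly_Mapping.keys p" "(Poly_Mapping.lookup p m when h m = w) \<noteq> 0"
        by (meson sum.not_neutral_contains_not_neutral)
      then show "w \<in> h ` Poly_Mapping.keys p" by auto
    qed
    show "h ` Poly_Mapping.keys p \<subseteq> Poly_Mapping.keys q"
      by (auto simp: in_keys_iff look)
  qed
  have "homogeneous d q"
    by (auto simp: homogeneous_def keys monom_degree_hvar[of "h _"] mk hH le)
  moreover have "dehomogenise q = p"
  proof -
    have "dehomogenise q =
        (\<Sum>m\<in>Poly_Mapping.keys p. Poly_Mapping.single m (Poly_Mapping.lookup p m))"
      unfolding dehomogenise_eq keys
      by (subst sum.reindex[OF inj_on_subset[OF inj subset_UNIV]]) (simp add: mk look)
    also have "\<dots> = p"
      by (rule poly_mapping_eqI)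
        (auto simp: lookup_sum lookup_single when_def sum.delta in_keys_iff)
    finally show ?thesis .
  qed
  ultimately show ?thesis by blast
qed

lemma ex1_homogenisation: "\<exists>!q. is_homogenisation p q"
proof -
  let ?P = "\<lambda>d. \<exists>q. homogeneous d q \<and> dehomogenise q = p"
  have ex: "\<exists>d. ?P d" using homogeneous_lift_exists by blast
  define d where "d = (LEAST d. ?P d)"
  obtain q where q: "homogeneous d q" "dehomogenise q = p"
    using LeastI_ex[OF ex] unfolding d_def by blast
  have min: "d \<le> d'" if "homogeneous d' q'" "dehomogenise q' = p" for d' q'
    unfolding d_def using that by (intro Least_le) blast
  show ?thesis
  proof (rule ex1I[of _ q])
    show "is_homogenisation p q"
      unfolding is_homogenisation_def using q min by blast
  next
    fix q' assume "is_homogenisation p q'"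
    then obtain d' where d': "homogeneous d' q'" "dehomogenise q' = p"
      and min': "\<And>d'' q''. homogeneous d'' q'' \<Longrightarrow> dehomogenise q'' = p \<Longrightarrow> d' \<le> d''"
      unfolding is_homogenisation_def by blast
    from min[OF d'] min'[OF q] have "d' = d" by simp
    with d' q show "q' = q" by (metis dehomogenise_inj)
  qed
qed

lemma is_homogenisation_homogenise: "is_homogenisation p (homogenise p)"
  unfolding homogenise_def by (rule theI') (rule ex1_homogenisation)

end

theory Submission
  imports Defs "Jordan_Normal_Form.Schur_Decomposition"
begin

text \<open>Write \<open>x\<close> for the variable of the bound colour, \<open>y\<close> for the homogenising variable and \<open>z\<^sub>i\<close> for that
of \<open>a\<^sub>i\<close>. Sorting independent sets by whether they contain the centre gives, for \<open>n \<ge> 1\<close>,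
\<open>H(C(\<L>\<^sub>n)) = (x + y)^n (x y^(n - 1) + \<Prod>i. (x + y + z\<^sub>i))\<close>.
Without the summand \<open>x y^(n - 1)\<close> this is a product of linear forms, hence Lorentzian. That summand
involves no \<open>z\<^sub>i\<close>, so it only affects those Hessians in which no \<open>z\<^sub>i\<close> has been differentiated, and
the point is that the factor \<open>(x y)^k\<close> with large \<open>k\<close> leaves room for it.

In coefficients: the monomial \<open>x^(k + e) y^(k + f) z^T\<close> of \<open>(x y)^k H(C(\<L>\<^sub>n))\<close>, where \<open>T\<close> is a set of
\<open>t\<close> indices and \<open>e + f + t = 2 n\<close>, has coefficient \<open>2 n - t choose e\<close>, plus \<open>n choose (e - 1)\<close> if
\<open>T\<close> is empty and \<open>e > 0\<close> (\<open>lookup_L_poly\<close>). All these coefficients are positive. So the support is the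
set of integer points of a box on a hyperplane, which is M-convex (\<open>M_convex_box_slice\<close>).

The Hessians are handled by a criterion that avoids their characteristic polynomials: a real symmetric
matrix whose quadratic form is \<open>\<le> 0\<close> on some hyperplane through the origin has at most one positive
eigenvalue, because two positive eigenvalues would yield orthogonal eigenvectors spanning a plane on
which the form is positive, and a plane meets every hyperplane (\<open>at_most_one_positive_eigenvalueI\<close>). The
entries of a Hessian are coefficients of the polynomial times factorials of the exponents
(\<open>hessian_fold_partial_deriv\<close>).

Differentiate \<open>I\<close> times by \<open>x\<close>, \<open>J\<close> times by \<open>y\<close> and once by each \<open>z\<^sub>i\<close> with \<open>i \<in> S\<close>. If \<open>I < k\<close>, every
term of the resulting quadratic form contains \<open>x\<close>, and the form vanishes on \<open>x = 0\<close>; likewise for \<open>J\<close>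
and \<open>y\<close>. Otherwise \<open>I = k + \<alpha>\<close> and \<open>J = k + \<beta>\<close>, the form depends on the \<open>z\<^sub>i\<close> only through the
sum \<open>s\<close> and the sum of squares \<open>Q\<close> of those with \<open>i \<notin> S\<close>, and with \<open>N = 2 n - card S = \<alpha> + \<beta> + 2\<close> the hyperplane
\<open>N ((I + 1) x / (\<alpha> + 1) + (J + 1) y / (\<beta> + 1)) + s = 0\<close> works. For nonempty \<open>S\<close> this follows from
\<open>s\<^sup>2 \<le> N Q\<close> for every \<open>k\<close> (\<open>kernel_form_unperturbed_nonpos\<close>). For empty \<open>S\<close> the better estimate
\<open>s\<^sup>2 \<le> n Q = (N / 2) Q\<close> is available; as \<open>k\<close> tends to infinity the remaining binary form in \<open>x\<close> and
\<open>y\<close> tends to one that is strictly diagonally dominant with negative diagonal, by elementary estimates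
of \<open>n choose j\<close> against \<open>2 n choose j\<close> (\<open>perturbed_form_nonpos_eventually\<close>). There are finitely many pairs
\<open>(\<alpha>, \<beta>)\<close>, so a single \<open>k\<close> serves all of them.\<close>


section \<open>A criterion for at most one positive eigenvalue\<close>

lemma ex_positive_root:
  assumes "size {#r \<in># proots (p::real poly). r > 0#} \<ge> 1"
  obtains r where "r > 0" "poly p r = 0"
proof -
  have "{#r \<in># proots p. r > 0#} \<noteq> {#}"
  proof
    assume "{#r \<in># proots p. r > 0#} = {#}"
    with assms show False by (simp only: size_empty)
  qed
  then obtain r where "r \<in># {#r \<in># proots p. r > 0#}" by (meson multiset_nonemptyE)
  then have r: "r \<in># proots p" "r > 0" by auto
  then have "p \<noteq> 0" by auto
  with r show ?thesis using that[of r] by (simp add: set_count_proots)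
qed

text \<open>Multiplicities are algebraic, so a double root of the characteristic polynomial must also produce two
eigenvectors. In a basis whose first vector is an eigenvector \<open>v\<close> the matrix becomes block upper
triangular, and deflating removes one root. A second positive root belongs to the transpose of the lower
right block; its eigenvector, padded with a zero and transformed back by the transposed inverse, is
orthogonal to \<open>v\<close>, and by symmetry of the matrix it is again an eigenvector.\<close>

lemma symmetric_two_positive_eigenvectors:
  fixes A :: "real mat"
  assumes A: "A \<in> carrier_mat n n" and sym: "transpose_mat A = A"
    and size: "size {#r \<in># proots (char_poly A). r > 0#} \<ge> 2"
  obtains v w \<mu> \<nu> where "v \<in> carrier_vec n" "w \<in> carrier_vec n" "v \<noteq> 0\<^sub>v n" "w \<noteq> 0\<^sub>v n"
    "\<mu> > 0" "\<nu> > 0" "A *\<^sub>v v = \<mu> \<cdot>\<^sub>v v" "A *\<^sub>v w = \<nu> \<cdot>\<^sub>v w" "v \<bullet> w = 0"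
proof -
  let ?n1 = "n - 1"
  obtain e where e: "e > 0" "poly (char_poly A) e = 0"
    using ex_positive_root[of "char_poly A"] size by auto
  from e have "eigenvalue A e" using eigenvalue_root_char_poly[OF A] by auto
  then obtain v where "eigenvector A v e" by (auto simp: eigenvalue_def)
  then have v: "v \<in> carrier_vec n" and v0: "v \<noteq> 0\<^sub>v n" and ev: "A *\<^sub>v v = e \<cdot>\<^sub>v v"
    using A by (auto simp: eigenvector_def)
  have n: "n \<noteq> 0"
  proof
    assume "n = 0"
    then have "v = 0\<^sub>v n" using v by auto
    with v0 show False ..
  qed
  define b where "b = basis_completion v"
  define ws where "ws = gram_schmidt n b"
  define W where "W = mat_of_cols n ws"
  define W' where "W' = corthogonal_inv W"
  define B where "B = W' * A * W"
  interpret cof_vec_space n "TYPE(real)" .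
  from basis_completion[OF v v0, folded b_def]
  have dist_b: "distinct b" and indep: "\<not> lin_dep (set b)" and b: "set b \<subseteq> carrier_vec n"
    and hdb: "hd b = v" and len_b: "length b = n" by auto
  from hdb len_b n obtain vs where bv: "b = v # vs" by (cases b) auto
  from gram_schmidt_result[OF b dist_b indep refl, folded ws_def]
  have ws: "set ws \<subseteq> carrier_vec n" "corthogonal ws" "length ws = n"
    by (auto simp: len_b)
  from gram_schmidt_hd[OF v, of vs, folded bv] have hdws: "hd ws = v" unfolding ws_def .
  have orth_W: "corthogonal_mat W" using orthogonal_mat_of_cols ws unfolding W_def .
  have W: "W \<in> carrier_mat n n"
    using ws unfolding W_def using mat_of_cols_carrier(1)[of n ws] by auto
  have W': "W' \<in> carrier_mat n n" unfolding W'_def corthogonal_inv_def using W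
    by (auto simp: mat_of_rows_def)
  from corthogonal_inv_result[OF orth_W]
  have W'W: "W' * W = 1\<^sub>m n" using W' unfolding W'_def[symmetric] inverts_mat_def by auto
  have WW': "W * W' = 1\<^sub>m n" using mat_mult_left_right_inverse[OF W' W W'W] .
  have B: "B \<in> carrier_mat n n" using W W' A unfolding B_def by auto
  have "similar_mat_wit B A W' W"
    by (rule similar_mat_witI[of _ _ n], insert W W' A B W'W WW', auto simp: B_def)
  then have simBA: "similar_mat B A" unfolding similar_mat_def by blast
  have col0: "col B 0 = vec n (\<lambda>i. if i = 0 then e else 0)"
    unfolding B_def W'_def W_def
    using corthogonal_col_ev_0[OF A v v0 ev n hdws ws] .
  have B0: "B $$ (i, 0) = (if i = 0 then e else 0)" if "i < n" for i
    using arg_cong[OF col0, of "\<lambda>v. v $ i"] B that n by auto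
  obtain A1 A2 A0 A3 where split: "split_block B 1 1 = (A1,A2,A0,A3)"
    by (cases "split_block B 1 1") auto
  from B n have "dim_row B = 1 + ?n1" "dim_col B = 1 + ?n1" by auto
  from split_block[OF split this] have A2: "A2 \<in> carrier_mat 1 ?n1"
    and A3: "A3 \<in> carrier_mat ?n1 ?n1" and block: "B = four_block_mat A1 A2 A0 A3" by auto
  have A1id: "A1 = mat 1 1 (\<lambda>_. e)"
    using split[unfolded split_block_def Let_def] B0[of 0] n by auto
  have A1: "A1 \<in> carrier_mat 1 1" unfolding A1id by auto
  have A0id: "A0 = 0\<^sub>m ?n1 1"
    using split[unfolded split_block_def Let_def] B0 B by auto
  have "char_poly A = char_poly B" using char_poly_similar[OF simBA] by simp
  also have "\<dots> = char_poly A1 * char_poly A3"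
    unfolding block A0id by (rule char_poly_four_block_zeros_col[OF A1 A2 A3])
  also have "char_poly A1 = [:-e, 1:]"
    by (simp add: A1id char_poly_defs det_def sign_def)
  finally have cp: "char_poly A = [:-e, 1:] * char_poly A3" .
  have nz: "char_poly A3 \<noteq> 0" using degree_monic_char_poly[OF A3] by auto
  have "proots (char_poly A) = {#e#} + proots (char_poly A3)"
    unfolding cp using nz by (subst proots_mult) auto
  with size e(1) have "size {#r \<in># proots (char_poly A3). r > 0#} \<ge> 1" by simp
  then obtain f where f: "f > 0" "poly (char_poly A3) f = 0"
    by (rule ex_positive_root)
  have A3t: "transpose_mat A3 \<in> carrier_mat ?n1 ?n1" using A3 by simp
  have "eigenvalue (transpose_mat A3) f"
    using f eigenvalue_root_char_poly[OF A3t] A3 by simp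
  then obtain w' where "eigenvector (transpose_mat A3) w' f" by (auto simp: eigenvalue_def)
  then have w': "w' \<in> carrier_vec ?n1" and w'0: "w' \<noteq> 0\<^sub>v ?n1"
    and evw': "transpose_mat A3 *\<^sub>v w' = f \<cdot>\<^sub>v w'"
    using A3 by (auto simp: eigenvector_def)
  \<comment> \<open>The padding by \<open>0\<close> makes \<open>g\<close> an eigenvector of the transposed block matrix.\<close>
  define g where "g = 0\<^sub>v 1 @\<^sub>v w'"
  have g: "g \<in> carrier_vec n"
    using append_carrier_vec[OF zero_carrier_vec[of 1] w'] n by (simp add: g_def)
  have g0: "g $ 0 = 0" by (simp add: g_def)
  have gn0: "g \<noteq> 0\<^sub>v n"
  proof
    assume g00: "g = 0\<^sub>v n"
    have "w' = 0\<^sub>v ?n1"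
    proof (rule eq_vecI)
      fix i assume "i < dim_vec (0\<^sub>v ?n1)"
      then show "w' $ i = 0\<^sub>v ?n1 $ i"
        using arg_cong[OF g00, of "\<lambda>v. v $ Suc i"] w' by (auto simp: g_def)
    qed (use w' in auto)
    with w'0 show False ..
  qed
  have Bt: "transpose_mat B = four_block_mat (transpose_mat A1) (0\<^sub>m 1 ?n1) (transpose_mat A2) (transpose_mat A3)"
    unfolding block A0id using A1 A2 A3 by (subst transpose_four_block_mat) auto
  have Bg: "transpose_mat B *\<^sub>v g = f \<cdot>\<^sub>v g"
  proof -
    have "transpose_mat B *\<^sub>v g = (transpose_mat A1 *\<^sub>v 0\<^sub>v 1 + 0\<^sub>m 1 ?n1 *\<^sub>v w') @\<^sub>v
        (transpose_mat A2 *\<^sub>v 0\<^sub>v 1 + transpose_mat A3 *\<^sub>v w')"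
      unfolding Bt g_def using A1 A2 A3 w' by (subst four_block_mat_mult_vec) auto
    also have "\<dots> = 0\<^sub>v 1 @\<^sub>v (f \<cdot>\<^sub>v w')"
      unfolding evw' using A2 w' by (intro arg_cong2[where f = append_vec] eq_vecI) (auto simp: A1id scalar_prod_def)
    also have "\<dots> = f \<cdot>\<^sub>v g"
      unfolding g_def by (rule eq_vecI) (auto simp: append_vec_def Let_def)
    finally show ?thesis .
  qed
  define w where "w = transpose_mat W' *\<^sub>v g"
  have w: "w \<in> carrier_vec n" using W' g by (auto simp: w_def)
  have Ww: "transpose_mat W *\<^sub>v w = g"
  proof -
    have "transpose_mat W *\<^sub>v w = (transpose_mat W * transpose_mat W') *\<^sub>v g"
      unfolding w_def using W W' g by (subst assoc_mult_mat_vec[of _ n n _ n]) auto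
    also have "transpose_mat W * transpose_mat W' = transpose_mat (W' * W)"
      using W W' by (subst transpose_mult) auto
    finally show ?thesis using g by (simp add: W'W)
  qed
  have "w \<noteq> 0\<^sub>v n" using Ww gn0 W by auto
  moreover have "v \<bullet> w = 0"
  proof -
    have "v = col W 0"
      unfolding W_def using ws hdws n by (cases ws) (auto simp: mat_of_cols_def col_def intro!: eq_vecI)
    then have "v \<bullet> w = (transpose_mat W *\<^sub>v w) $ 0"
      using W n by simp
    with Ww g0 show ?thesis by simp
  qed
  moreover have "A *\<^sub>v w = f \<cdot>\<^sub>v w"
  proof -
    have tB: "transpose_mat B = transpose_mat W * (A * transpose_mat W')"
      unfolding B_def using W W' A
      by (subst transpose_mult[of _ n n], auto) (subst transpose_mult[of _ n n], auto simp: sym)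
    have I: "transpose_mat W' * transpose_mat W = 1\<^sub>m n"
      using transpose_mult[OF W W'] WW' by simp
    have "f \<cdot>\<^sub>v w = transpose_mat W' *\<^sub>v (transpose_mat B *\<^sub>v g)"
      unfolding Bg w_def using W' g by (subst mult_mat_vec[of _ n n]) auto
    also have "\<dots> = (transpose_mat W' * (transpose_mat W * (A * transpose_mat W'))) *\<^sub>v g"
      unfolding tB using W W' A g by (subst assoc_mult_mat_vec[of _ n n _ n]) auto
    also have "transpose_mat W' * (transpose_mat W * (A * transpose_mat W')) = A * transpose_mat W'"
      using W W' A I by (subst assoc_mult_mat[symmetric, of _ n n _ n _ n]) auto
    also have "\<dots> *\<^sub>v g = A *\<^sub>v w"
      unfolding w_def using W' A g by (subst assoc_mult_mat_vec[of _ n n _ n]) auto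
    finally show ?thesis by simp
  qed
  ultimately show ?thesis using that v v0 w e(1) f(1) ev by blast
qed

lemma at_most_one_positive_eigenvalueI:
  assumes A: "A \<in> carrier_mat n n" and sym: "transpose_mat A = A" and l: "l \<in> carrier_vec n"
    and nonpos: "\<And>x. x \<in> carrier_vec n \<Longrightarrow> l \<bullet> x = 0 \<Longrightarrow> x \<bullet> (A *\<^sub>v x) \<le> 0"
  shows "at_most_one_positive_eigenvalue A"
proof (rule ccontr)
  assume "\<not> at_most_one_positive_eigenvalue A"
  then have "size {#r \<in># proots (char_poly A). r > 0#} \<ge> 2"
    by (simp add: at_most_one_positive_eigenvalue_def)
  from symmetric_two_positive_eigenvectors[OF A sym this]
  obtain v w \<mu> \<nu> where v: "v \<in> carrier_vec n" and w: "w \<in> carrier_vec n"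
    and v0: "v \<noteq> 0\<^sub>v n" and w0: "w \<noteq> 0\<^sub>v n" and pos: "\<mu> > 0" "\<nu> > 0"
    and ev: "A *\<^sub>v v = \<mu> \<cdot>\<^sub>v v" and ew: "A *\<^sub>v w = \<nu> \<cdot>\<^sub>v w" and vw: "v \<bullet> w = 0" by blast
  have wv: "w \<bullet> v = 0" using vw comm_scalar_prod[OF v w] by simp
  have vv: "v \<bullet> v > 0" and ww: "w \<bullet> w > 0"
    using conjugate_square_greater_0_vec[OF v] conjugate_square_greater_0_vec[OF w] v0 w0
    by (simp_all add: conjugate_vec_def)
  \<comment> \<open>These coefficients give a nonzero vector in the plane of \<open>v\<close> and \<open>w\<close> that is orthogonal to \<open>l\<close>.\<close>
  define \<alpha> \<beta> where "\<alpha> = (if l \<bullet> v = 0 then 1 else l \<bullet> w)" and "\<beta> = (if l \<bullet> v = 0 then 0 else - (l \<bullet> v))"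
  define x where "x = \<alpha> \<cdot>\<^sub>v v + \<beta> \<cdot>\<^sub>v w"
  have x: "x \<in> carrier_vec n" using v w by (simp add: x_def)
  have "l \<bullet> x = \<alpha> * (l \<bullet> v) + \<beta> * (l \<bullet> w)"
    unfolding x_def using v w l by (simp add: scalar_prod_add_distrib[of _ n])
  then have "l \<bullet> x = 0" by (simp add: \<alpha>_def \<beta>_def)
  from nonpos[OF x this] have "x \<bullet> (A *\<^sub>v x) \<le> 0" .
  moreover have "A *\<^sub>v x = (\<alpha> * \<mu>) \<cdot>\<^sub>v v + (\<beta> * \<nu>) \<cdot>\<^sub>v w"
    unfolding x_def using A v w
    by (simp add: mult_add_distrib_mat_vec[of _ n n] mult_mat_vec[of _ n n] ev ew smult_smult_assoc)
  then have "x \<bullet> (A *\<^sub>v x) = \<alpha>\<^sup>2 * \<mu> * (v \<bullet> v) + \<beta>\<^sup>2 * \<nu> * (w \<bullet> w)"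
    unfolding x_def using v w
    by (simp add: scalar_prod_add_distrib[of _ n] add_scalar_prod_distrib[of _ n] vw wv power2_eq_square)
  moreover have "\<alpha>\<^sup>2 * \<mu> * (v \<bullet> v) + \<beta>\<^sup>2 * \<nu> * (w \<bullet> w) > 0"
  proof (cases "l \<bullet> v = 0")
    case True
    then show ?thesis using pos vv by (simp add: \<alpha>_def \<beta>_def)
  next
    case False
    then have "\<beta>\<^sup>2 * \<nu> * (w \<bullet> w) > 0" using pos ww by (simp add: \<beta>_def)
    moreover have "\<alpha>\<^sup>2 * \<mu> * (v \<bullet> v) \<ge> 0" using pos vv by simp
    ultimately show ?thesis by linarith
  qed
  ultimately show False by linarith
qed


section \<open>Hessians in terms of coefficients\<close>

lemma minus_single_eq_iff:
  fixes m :: "'v \<Rightarrow>\<^sub>0 nat"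
  assumes "Poly_Mapping.lookup m v \<noteq> 0"
  shows "m - Poly_Mapping.single v 1 = m' \<longleftrightarrow> m = m' + Poly_Mapping.single v 1"
proof
  assume "m - Poly_Mapping.single v 1 = m'"
  then show "m = m' + Poly_Mapping.single v 1"
    using assms by (intro poly_mapping_eqI)
      (auto simp: lookup_add lookup_minus lookup_single when_def)
qed auto

lemma lookup_partial_deriv:
  "Poly_Mapping.lookup (partial_deriv v p) m =
     real (Poly_Mapping.lookup m v + 1) * Poly_Mapping.lookup p (m + Poly_Mapping.single v 1)"
proof -
  let ?e = "Poly_Mapping.single v (1::nat)"
  have "Poly_Mapping.lookup (partial_deriv v p) m =
     (\<Sum>m'\<in>Poly_Mapping.keys p. (real (Poly_Mapping.lookup m' v) * Poly_Mapping.lookup p m' when m' - ?e = m))"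
    by (simp add: partial_deriv_def lookup_sum lookup_single)
  also have "\<dots> = (\<Sum>m'\<in>Poly_Mapping.keys p.
      if m' = m + ?e then real (Poly_Mapping.lookup m' v) * Poly_Mapping.lookup p m' else 0)"
  proof (intro sum.cong refl)
    fix m'
    show "(real (Poly_Mapping.lookup m' v) * Poly_Mapping.lookup p m' when m' - ?e = m) =
      (if m' = m + ?e then real (Poly_Mapping.lookup m' v) * Poly_Mapping.lookup p m' else 0)"
      using minus_single_eq_iff[of m' v m]
      by (cases "Poly_Mapping.lookup m' v = 0") (auto simp: when_def)
  qed
  also have "\<dots> = real (Poly_Mapping.lookup m v + 1) * Poly_Mapping.lookup p (m + ?e)"
    by (simp add: sum.delta' in_keys_iff lookup_add)
  finally show ?thesis .
qed

text \<open>With the coefficients multiplied by the factorials of the exponents, differentiation becomes a mere shift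
of the exponent vector.\<close>

definition exponent_fact :: "('v \<Rightarrow>\<^sub>0 nat) \<Rightarrow> real" where
  "exponent_fact m = (\<Prod>v\<in>Poly_Mapping.keys m. fact (Poly_Mapping.lookup m v))"

definition normalised_coeff :: "'v mpoly \<Rightarrow> ('v \<Rightarrow>\<^sub>0 nat) \<Rightarrow> real" where
  "normalised_coeff p m = exponent_fact m * Poly_Mapping.lookup p m"

lemma exponent_fact_superset:
  assumes "finite K" "Poly_Mapping.keys m \<subseteq> K"
  shows "exponent_fact m = (\<Prod>v\<in>K. fact (Poly_Mapping.lookup m v))"
  unfolding exponent_fact_def using assms
  by (intro prod.mono_neutral_left) (auto simp: in_keys_iff)

lemma exponent_fact_add_single:
  "exponent_fact (m + Poly_Mapping.single v 1) = real (Poly_Mapping.lookup m v + 1) * exponent_fact m"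
proof -
  let ?K = "insert v (Poly_Mapping.keys m)"
  have "exponent_fact (m + Poly_Mapping.single v 1) =
      (\<Prod>u\<in>?K. fact (Poly_Mapping.lookup (m + Poly_Mapping.single v 1) u))"
    by (rule exponent_fact_superset)
      (auto simp: in_keys_iff lookup_add lookup_single when_def split: if_splits)
  also have "\<dots> = fact (Poly_Mapping.lookup m v + 1) *
      (\<Prod>u\<in>?K - {v}. fact (Poly_Mapping.lookup (m + Poly_Mapping.single v 1) u))"
    by (subst prod.remove[of _ v]) (auto simp: lookup_add)
  also have "(\<Prod>u\<in>?K - {v}. fact (Poly_Mapping.lookup (m + Poly_Mapping.single v 1) u)) =
      (\<Prod>u\<in>?K - {v}. fact (Poly_Mapping.lookup m u) :: real)"
    by (intro prod.cong) (auto simp: lookup_add lookup_single when_def)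
  also have "fact (Poly_Mapping.lookup m v + 1) * \<dots> = real (Poly_Mapping.lookup m v + 1) *
      (fact (Poly_Mapping.lookup m v) * (\<Prod>u\<in>?K - {v}. fact (Poly_Mapping.lookup m u)))"
    by simp
  also have "fact (Poly_Mapping.lookup m v) * (\<Prod>u\<in>?K - {v}. fact (Poly_Mapping.lookup m u)) =
      (\<Prod>u\<in>?K. fact (Poly_Mapping.lookup m u) :: real)"
    by (subst (2) prod.remove[of _ v]) auto
  also have "\<dots> = exponent_fact m"
    by (rule exponent_fact_superset[symmetric]) auto
  finally show ?thesis .
qed

lemma normalised_coeff_fold_partial_deriv:
  "normalised_coeff (fold partial_deriv us p) m =
     normalised_coeff p (m + (\<Sum>u\<leftarrow>us. Poly_Mapping.single u 1))"
proof (induction us arbitrary: p)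
  case (Cons u us)
  let ?m = "m + (\<Sum>u\<leftarrow>us. Poly_Mapping.single u 1)"
  have "normalised_coeff (partial_deriv u p) ?m = normalised_coeff p (?m + Poly_Mapping.single u 1)"
    unfolding normalised_coeff_def lookup_partial_deriv exponent_fact_add_single by (simp only: ac_simps)
  then show ?case
    by (simp add: Cons.IH ac_simps)
qed simp

lemma hessian_fold_partial_deriv:
  assumes "i < length vs" "j < length vs"
  shows "hessian vs (fold partial_deriv us p) $$ (i, j) =
    normalised_coeff p ((\<Sum>u\<leftarrow>us. Poly_Mapping.single u 1)
      + Poly_Mapping.single (vs ! i) 1 + Poly_Mapping.single (vs ! j) 1)"
proof -
  let ?us = "us @ [vs ! j, vs ! i]"
  have "hessian vs (fold partial_deriv us p) $$ (i, j) =
      normalised_coeff (fold partial_deriv ?us p) 0"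
    using assms by (simp add: hessian_def normalised_coeff_def exponent_fact_def)
  also have "\<dots> = normalised_coeff p (\<Sum>u\<leftarrow>?us. Poly_Mapping.single u 1)"
    by (simp only: normalised_coeff_fold_partial_deriv add_0)
  finally show ?thesis by (simp add: add_ac)
qed

lemma monom_degree_add: "monom_degree (m + m') = monom_degree m + monom_degree m'"
proof -
  let ?K = "Poly_Mapping.keys m \<union> Poly_Mapping.keys m'"
  have "Poly_Mapping.keys (m + m') \<subseteq> ?K" by (rule Poly_Mapping.keys_add)
  then show ?thesis
    by (simp add: monom_degree_superset[of ?K] lookup_add sum.distrib)
qed

lemma monom_degree_single [simp]: "monom_degree (Poly_Mapping.single v e) = e"
  by (cases "e = 0") (simp_all add: monom_degree_def)

lemma monom_degree_sum_list_single:
  "monom_degree (\<Sum>u\<leftarrow>us. Poly_Mapping.single u 1) = length us"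
  by (induction us) (simp_all add: monom_degree_add, simp add: monom_degree_def)

lemma keys_sum_list_single:
  "Poly_Mapping.keys (\<Sum>u\<leftarrow>us. Poly_Mapping.single u (1::nat)) \<subseteq> set us"
proof (induction us)
  case (Cons u us)
  then show ?case using Poly_Mapping.keys_add[of "Poly_Mapping.single u (1::nat)"] by fastforce
qed simp

definition hessian_form :: "'v set \<Rightarrow> 'v mpoly \<Rightarrow> ('v \<Rightarrow>\<^sub>0 nat) \<Rightarrow> ('v \<Rightarrow> real) \<Rightarrow> real" where
  "hessian_form W p \<mu> \<xi> = (\<Sum>v\<in>W. \<Sum>w\<in>W. \<xi> v * \<xi> w *
     normalised_coeff p (\<mu> + Poly_Mapping.single v 1 + Poly_Mapping.single w 1))"

text \<open>The Hessian after differentiating by \<open>us\<close> depends only on the exponent vector \<open>\<mu>\<close> that counts how often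
each variable occurs in \<open>us\<close>. Hence the eigenvalue condition reduces to the existence, for each \<open>\<mu>\<close>, of a
hyperplane on which the form is nonpositive. The linear form \<open>l\<close> may be zero; the condition then requires
the form to be nonpositive everywhere.\<close>

lemma lorentzianI:
  assumes W: "finite W" "\<And>m. m \<in> Poly_Mapping.keys p \<Longrightarrow> Poly_Mapping.keys m \<subseteq> W"
    and hom: "homogeneous d p"
    and nonneg: "\<And>m. Poly_Mapping.lookup p m \<ge> 0"
    and M: "M_convex W (support p)"
    and form: "\<And>\<mu>. monom_degree \<mu> + 2 = d \<Longrightarrow> Poly_Mapping.keys \<mu> \<subseteq> W \<Longrightarrow>
      \<exists>l. \<forall>\<xi>. (\<Sum>v\<in>W. l v * \<xi> v) = 0 \<longrightarrow> hessian_form W p \<mu> \<xi> \<le> 0"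
  shows "lorentzian W p"
proof -
  have "at_most_one_positive_eigenvalue (hessian vs (fold partial_deriv us p))"
    if us: "set us \<subseteq> W" "length us + 2 = d" and vs: "set vs = W" "distinct vs" for us vs
  proof -
    define \<mu> where "\<mu> = (\<Sum>u\<leftarrow>us. Poly_Mapping.single u (1::nat))"
    define N where "N = length vs"
    let ?H = "hessian vs (fold partial_deriv us p)"
    have H: "?H $$ (i, j) =
        normalised_coeff p (\<mu> + Poly_Mapping.single (vs ! i) 1 + Poly_Mapping.single (vs ! j) 1)"
      if "i < N" "j < N" for i j
      using that unfolding N_def \<mu>_def by (rule hessian_fold_partial_deriv)
    have Hc: "?H \<in> carrier_mat N N" by (simp add: hessian_def N_def)
    have Hsym: "transpose_mat ?H = ?H"
      using Hc by (intro eq_matI) (auto simp: H add_ac)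
    have "monom_degree \<mu> + 2 = d" "Poly_Mapping.keys \<mu> \<subseteq> W"
      using us keys_sum_list_single[of us] monom_degree_sum_list_single[of us]
      by (auto simp: \<mu>_def)
    from form[OF this] obtain l
      where l: "\<And>\<xi>. (\<Sum>v\<in>W. l v * \<xi> v) = 0 \<Longrightarrow> hessian_form W p \<mu> \<xi> \<le> 0" by blast
    have bij: "bij_betw (nth vs) {..<N} W"
      using bij_betw_nth[OF vs(2), of "{..<N}" W] vs(1) by (simp add: N_def)
    have reindex: "sum f W = (\<Sum>i<N. f (vs ! i))" for f :: "'a \<Rightarrow> real"
      using sum.reindex_bij_betw[OF bij, of f] by simp
    show ?thesis
    proof (rule at_most_one_positive_eigenvalueI[OF Hc Hsym, of "vec N (\<lambda>i. l (vs ! i))"])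
      fix x assume x: "x \<in> carrier_vec N" and lx: "vec N (\<lambda>i. l (vs ! i)) \<bullet> x = 0"
      define \<xi> where "\<xi> = (\<lambda>v. x $ inv_into {..<N} (nth vs) v)"
      have \<xi>: "\<xi> (vs ! i) = x $ i" if "i < N" for i
        unfolding \<xi>_def using bij_betw_inv_into_left[OF bij] that by simp
      have "(\<Sum>v\<in>W. l v * \<xi> v) = 0"
        using lx x by (simp add: reindex \<xi> scalar_prod_def atLeast0LessThan)
      from l[OF this] have "hessian_form W p \<mu> \<xi> \<le> 0" .
      moreover have "hessian_form W p \<mu> \<xi> = x \<bullet> (?H *\<^sub>v x)"
        using x Hc by (simp add: hessian_form_def reindex \<xi> scalar_prod_def atLeast0LessThan H
          sum_distrib_left mult_ac)
      ultimately show "x \<bullet> (?H *\<^sub>v x) \<le> 0" by simp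
    qed simp
  qed
  then show ?thesis
    unfolding lorentzian_def using W hom nonneg M by blast
qed

text \<open>If \<open>\<alpha>\<close> exceeds \<open>\<beta>\<close> at \<open>i\<close>, equality of the coordinate sums forces \<open>\<alpha>\<close> below \<open>\<beta>\<close> at some \<open>j\<close>. Moving one
unit from \<open>i\<close> to \<open>j\<close> stays between \<open>\<alpha>\<close> and \<open>\<beta>\<close> in every coordinate, hence inside the box.\<close>

lemma M_convex_box_slice:
  assumes "finite W" "finite A"
    and A: "A = {\<alpha>. (\<forall>v\<in>W. lo v \<le> \<alpha> v \<and> \<alpha> v \<le> hi v) \<and> (\<forall>v. v \<notin> W \<longrightarrow> \<alpha> v = 0) \<and> sum \<alpha> W = D}"
  shows "M_convex W A"
  unfolding M_convex_def
proof (intro conjI ballI impI)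
  fix \<alpha> \<beta> i assume \<alpha>: "\<alpha> \<in> A" and \<beta>: "\<beta> \<in> A" and i: "i \<in> W" "\<beta> i < \<alpha> i"
  have "\<exists>j\<in>W. \<alpha> j < \<beta> j"
  proof (rule ccontr)
    assume "\<not> (\<exists>j\<in>W. \<alpha> j < \<beta> j)"
    then have "sum \<beta> W < sum \<alpha> W"
      using i assms(1) by (intro sum_strict_mono_ex1) auto
    with \<alpha> \<beta> show False by (simp add: A)
  qed
  then obtain j where j: "j \<in> W" "\<alpha> j < \<beta> j" by blast
  let ?\<gamma> = "\<lambda>v. \<alpha> v - of_bool (v = i) + of_bool (v = j)"
  have "sum ?\<gamma> W = sum \<alpha> W"
    using assms(1) i j by (simp add: sum.distrib sum_subtractf of_bool_def sum.delta)
  moreover have "lo v \<le> ?\<gamma> v \<and> ?\<gamma> v \<le> hi v" if "v \<in> W" for v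
  proof -
    have "lo v \<le> \<alpha> v" "\<alpha> v \<le> hi v" "lo v \<le> \<beta> v" "\<beta> v \<le> hi v" using \<alpha> \<beta> that by (auto simp: A)
    with i j show ?thesis by (auto simp: of_bool_def)
  qed
  ultimately have "?\<gamma> \<in> A"
    using \<alpha> i j by (auto simp: A)
  with j show "\<exists>j\<in>W. \<alpha> j < \<beta> j \<and> (\<lambda>v. \<alpha> v - of_bool (v = i) + of_bool (v = j)) \<in> A" by blast
qed (rule assms(2))


section \<open>Coefficients of homogenisations and of independence polynomials\<close>

lemma lookup_map_key_Orig [simp]:
  "Poly_Mapping.lookup (Poly_Mapping.map_key Orig m) v = Poly_Mapping.lookup m (Orig v)"
  by (simp add: map_key.rep_eq inj_Orig)

text \<open>The minimal degree of a homogenisation is the degree of the polynomial: a homogenisation of larger degree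
\<open>e\<close> has all its monomials divisible by the power \<open>e - d\<close> of the homogenising variable, and dividing by it
would give one of smaller degree.\<close>

lemma homogeneous_homogenise:
  assumes le: "\<And>m. m \<in> Poly_Mapping.keys p \<Longrightarrow> monom_degree m \<le> d"
    and m0: "m0 \<in> Poly_Mapping.keys p" "monom_degree m0 = d"
  shows "homogeneous d (homogenise p)"
proof -
  obtain e where hom: "homogeneous e (homogenise p)" and deh: "dehomogenise (homogenise p) = p"
    and min: "\<And>e' q'. homogeneous e' q' \<Longrightarrow> dehomogenise q' = p \<Longrightarrow> e \<le> e'"
    using is_homogenisation_homogenise[of p] unfolding is_homogenisation_def by blast
  let ?q = "homogenise p"
  define s :: "('a hvar \<Rightarrow>\<^sub>0 nat) \<Rightarrow> 'a hvar \<Rightarrow>\<^sub>0 nat"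
    where "s m = m + Poly_Mapping.single Homog (e - d)" for m
  have "d \<le> e"
  proof -
    have "m0 \<in> Poly_Mapping.map_key Orig ` Poly_Mapping.keys ?q"
    proof (rule ccontr)
      assume "m0 \<notin> Poly_Mapping.map_key Orig ` Poly_Mapping.keys ?q"
      then have "Poly_Mapping.lookup (dehomogenise ?q) m0 = 0"
        by (auto simp: dehomogenise_eq lookup_sum lookup_single when_def intro!: sum.neutral)
      with m0 deh show False by (simp add: in_keys_iff)
    qed
    then obtain m where "m \<in> Poly_Mapping.keys ?q" "m0 = Poly_Mapping.map_key Orig m" by blast
    with m0 hom show ?thesis
      using monom_degree_hvar[of m] by (simp add: homogeneous_def)
  qed
  moreover have "e \<le> d"
  proof (rule min)
    have inj: "inj s" by (simp add: s_def inj_def)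
    \<comment> \<open>The quotient by the power of the homogenising variable.\<close>
    define q' where "q' = Poly_Mapping.map_key s ?q"
    have look: "Poly_Mapping.lookup q' m = Poly_Mapping.lookup ?q (s m)" for m
      by (simp add: q'_def map_key.rep_eq inj)
    have keys: "Poly_Mapping.keys ?q = s ` Poly_Mapping.keys q'"
    proof
      show "s ` Poly_Mapping.keys q' \<subseteq> Poly_Mapping.keys ?q"
        by (auto simp: in_keys_iff look)
      show "Poly_Mapping.keys ?q \<subseteq> s ` Poly_Mapping.keys q'"
      proof
        fix m assume m: "m \<in> Poly_Mapping.keys ?q"
        with hom have deg: "monom_degree m = e" by (simp add: homogeneous_def)
        have "Poly_Mapping.map_key Orig m \<in> Poly_Mapping.keys p"
          using lookup_dehomogenise[OF hom deg] m deh by (simp add: in_keys_iff)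
        from le[OF this] have "e - d \<le> Poly_Mapping.lookup m Homog"
          using monom_degree_hvar[of m] deg by simp
        then have "m = s (m - Poly_Mapping.single Homog (e - d))"
          by (intro poly_mapping_eqI) (auto simp: s_def lookup_add lookup_minus lookup_single when_def)
        with m show "m \<in> s ` Poly_Mapping.keys q'"
          by (metis image_eqI in_keys_iff look)
      qed
    qed
    show "homogeneous d q'"
      unfolding homogeneous_def
    proof
      fix m assume "m \<in> Poly_Mapping.keys q'"
      then have "s m \<in> Poly_Mapping.keys ?q" using keys by blast
      with hom have "monom_degree (s m) = e" by (simp add: homogeneous_def)
      with \<open>d \<le> e\<close> show "monom_degree m = d" by (simp add: s_def monom_degree_add)
    qed
    have "Poly_Mapping.map_key Orig (s m) = Poly_Mapping.map_key Orig m" for m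
      by (rule poly_mapping_eqI) (simp add: s_def lookup_add lookup_single when_def)
    then have "dehomogenise q' = dehomogenise ?q"
      unfolding dehomogenise_eq keys
      by (subst sum.reindex[OF inj_on_subset[OF inj subset_UNIV]]) (simp add: look)
    then show "dehomogenise q' = p" by (simp add: deh)
  qed
  ultimately show ?thesis using hom by simp
qed

lemma lookup_homogenise:
  assumes hom: "homogeneous d (homogenise p)"
  shows "Poly_Mapping.lookup (homogenise p) m =
    (if monom_degree m = d then Poly_Mapping.lookup p (Poly_Mapping.map_key Orig m) else 0)"
proof (cases "monom_degree m = d")
  case True
  have "dehomogenise (homogenise p) = p"
    using is_homogenisation_homogenise[of p] unfolding is_homogenisation_def by blast
  with lookup_dehomogenise[OF hom True] True show ?thesis by simp
next
  case False
  with hom show ?thesis by (auto simp: homogeneous_def in_keys_iff)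
qed

lemma lookup_single_times:
  fixes q :: "'v mpoly"
  shows "Poly_Mapping.lookup (Poly_Mapping.single a 1 * q) m =
    (if \<forall>v. Poly_Mapping.lookup a v \<le> Poly_Mapping.lookup m v then Poly_Mapping.lookup q (m - a) else 0)"
proof -
  have "Poly_Mapping.lookup (Poly_Mapping.single a 1 * q) m =
      (\<Sum>m'. Poly_Mapping.lookup q m' when m = a + m')"
    by (simp add: lookup_mult lookup_single when_mult)
  also have "\<dots> = (if \<forall>v. Poly_Mapping.lookup a v \<le> Poly_Mapping.lookup m v
      then Poly_Mapping.lookup q (m - a) else 0)"
  proof (cases "\<forall>v. Poly_Mapping.lookup a v \<le> Poly_Mapping.lookup m v")
    case True
    then have "m = a + m' \<longleftrightarrow> m' = m - a" for m'
      by (auto simp: poly_mapping_eq_iff fun_eq_iff lookup_add lookup_minus)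
    with True show ?thesis by simp
  next
    case False
    then have "m \<noteq> a + m'" for m' by (auto simp: lookup_add)
    then have "(\<Sum>m'. Poly_Mapping.lookup q m' when m = a + m') = 0" by simp
    with False show ?thesis by (simp only: if_False)
  qed
  finally show ?thesis .
qed

text \<open>The exponent vector of the monomial that a vertex set contributes to the independence polynomial.\<close>

definition set_monom :: "('v \<Rightarrow> 'c) \<Rightarrow> 'v set \<Rightarrow> 'c \<Rightarrow>\<^sub>0 nat" where
  "set_monom f S = (\<Sum>v\<in>S. Poly_Mapping.single (f v) 1)"

lemma lookup_set_monom:
  "finite S \<Longrightarrow> Poly_Mapping.lookup (set_monom f S) c = card {v\<in>S. f v = c}"
  by (simp add: set_monom_def lookup_sum lookup_single when_def sum.inter_filter[symmetric])

lemma lookup_coloured_independence_poly: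
  assumes "finite (verts G)"
  shows "Poly_Mapping.lookup (coloured_independence_poly G) m =
    real (card {S. independent_set G S \<and> set_monom (colour G) S = m})"
proof -
  let ?I = "{S. independent_set G S}"
  have fin: "finite ?I"
    by (rule finite_subset[of _ "Pow (verts G)"]) (use assms in \<open>auto simp: independent_set_def\<close>)
  have "(\<Prod>v\<in>S. var (colour G v)) = Poly_Mapping.single (set_monom (colour G) S) 1" if "S \<in> ?I" for S
  proof -
    have "finite S" using that assms by (auto simp: independent_set_def intro: finite_subset)
    then show ?thesis by (simp add: var_def set_monom_def prod_single)
  qed
  then have "Poly_Mapping.lookup (coloured_independence_poly G) m =
      (\<Sum>S\<in>?I. if set_monom (colour G) S = m then 1 else 0)"
    by (simp add: coloured_independence_poly_def lookup_sum lookup_single when_def)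
  also have "\<dots> = real (card {S\<in>?I. set_monom (colour G) S = m})"
    using fin by (simp flip: sum.inter_filter)
  finally show ?thesis by simp
qed


section \<open>Counting the independent sets of the graphs\<close>

lemma independent_set_L_graph:
  "independent_set (L_graph n) S \<longleftrightarrow> S \<subseteq> verts (L_graph n) \<and>
     (\<forall>i\<in>{1..n}. \<not> (Centre \<in> S \<and> Leaf i \<in> S) \<and> \<not> (Centre \<in> S \<and> A_vertex i \<in> S) \<and>
        \<not> (A_vertex i \<in> S \<and> B_vertex i \<in> S))"
  (is "_ \<longleftrightarrow> ?R")
proof
  assume S: "independent_set (L_graph n) S"
  have no: False if "u \<in> S" "v \<in> S" "{u, v} \<in> edges (L_graph n)" for u v
    using S that by (auto simp: independent_set_def)
  have "\<not> (Centre \<in> S \<and> Leaf i \<in> S) \<and> \<not> (Centre \<in> S \<and> A_vertex i \<in> S) \<and>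
      \<not> (A_vertex i \<in> S \<and> B_vertex i \<in> S)" if "i \<in> {1..n}" for i
  proof -
    have "{Centre, Leaf i} \<in> edges (L_graph n)" "{Centre, A_vertex i} \<in> edges (L_graph n)"
      "{A_vertex i, B_vertex i} \<in> edges (L_graph n)"
      using that by (auto simp: L_graph_def)
    then show ?thesis using no by blast
  qed
  with S show ?R by (simp add: independent_set_def)
next
  assume ?R
  then show "independent_set (L_graph n) S"
    unfolding independent_set_def by (auto simp: L_graph_def doubleton_eq_iff)
qed

lemma set_monom_L_col_eq_iff:
  assumes "finite S"
  shows "set_monom L_col S = m \<longleftrightarrow> card (S - range A_vertex) = Poly_Mapping.lookup m Bound \<and>
    (\<forall>i. Poly_Mapping.lookup m (Free i) = of_bool (A_vertex i \<in> S))"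
proof -
  have bound: "{v\<in>S. L_col v = Bound} = S - range A_vertex"
  proof (intro Set.set_eqI iffI)
    fix v assume "v \<in> S - range A_vertex"
    then show "v \<in> {v\<in>S. L_col v = Bound}" by (cases v) auto
  qed auto
  have free: "card {v\<in>S. L_col v = Free i} = of_bool (A_vertex i \<in> S)" for i
  proof -
    have "{v\<in>S. L_col v = Free i} = (if A_vertex i \<in> S then {A_vertex i} else {})"
    proof (intro Set.set_eqI iffI)
      fix v assume "v \<in> {v\<in>S. L_col v = Free i}"
      then show "v \<in> (if A_vertex i \<in> S then {A_vertex i} else {})" by (cases v) auto
    qed (auto split: if_splits)
    then show ?thesis by simp
  qed
  show ?thesis
    unfolding poly_mapping_eq_iff fun_eq_iff
  proof safe
    assume *: "card (S - range A_vertex) = Poly_Mapping.lookup m Bound"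
      "\<forall>i. Poly_Mapping.lookup m (Free i) = of_bool (A_vertex i \<in> S)"
    fix c show "Poly_Mapping.lookup (set_monom L_col S) c = Poly_Mapping.lookup m c"
      using * by (cases c) (simp_all add: lookup_set_monom assms bound free)
  next
    assume *: "\<forall>c. Poly_Mapping.lookup (set_monom L_col S) c = Poly_Mapping.lookup m c"
    show "card (S - range A_vertex) = Poly_Mapping.lookup m Bound"
      using *[rule_format, of Bound] by (simp add: lookup_set_monom assms bound)
    fix i show "Poly_Mapping.lookup m (Free i) = of_bool (A_vertex i \<in> S)"
      using *[rule_format, of "Free i"] by (simp add: lookup_set_monom assms free)
  qed
qed

text \<open>The number of independent sets that contain \<open>t\<close> prescribed vertices \<open>a\<^sub>i\<close>, no other \<open>a\<^sub>i\<close>, and \<open>e\<close> bound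
vertices. Without the centre, the \<open>e\<close> bound vertices are chosen among \<open>n\<close> leaves and \<open>n - t\<close> vertices
\<open>b\<^sub>i\<close>. With the centre, \<open>t\<close> has to be \<open>0\<close> and the other \<open>e - 1\<close> are chosen among the \<open>n\<close> vertices \<open>b\<^sub>i\<close>.\<close>

definition L_coeff :: "nat \<Rightarrow> nat \<Rightarrow> nat \<Rightarrow> nat" where
  "L_coeff n t e = (2 * n - t choose e) + (if t = 0 \<and> e > 0 then n choose (e - 1) else 0)"

lemma card_independent_sets_L_graph:
  assumes T: "T \<subseteq> {1..n}" and free: "\<And>i. Poly_Mapping.lookup m (Free i) = of_bool (i \<in> T)"
  shows "card {S. independent_set (L_graph n) S \<and> set_monom L_col S = m} =
    L_coeff n (card T) (Poly_Mapping.lookup m Bound)"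
proof -
  define e where "e = Poly_Mapping.lookup m Bound"
  define V where "V = Leaf ` {1..n} \<union> B_vertex ` ({1..n} - T)"
  \<comment> \<open>The families of the sets without and with the centre.\<close>
  define F1 where "F1 = (\<lambda>U. A_vertex ` T \<union> U) ` {U. U \<subseteq> V \<and> card U = e}"
  define F2 where "F2 = (if T = {} \<and> e > 0
    then insert Centre ` {U. U \<subseteq> B_vertex ` {1..n} \<and> card U = e - 1} else {})"
  have finT: "finite T" using T finite_subset by blast
  have V: "finite V" "V \<inter> range A_vertex = {}" "Centre \<notin> V" by (auto simp: V_def)
  have cardV: "card V = 2 * n - card T"
  proof -
    have "card V = card (Leaf ` {1..n}) + card (B_vertex ` ({1..n} - T))"
      unfolding V_def by (rule card_Un_disjoint) auto
    also have "\<dots> = n + (n - card T)"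
      using T finT by (subst (1 2) card_image) (auto simp: inj_on_def card_Diff_subset)
    also have "\<dots> = 2 * n - card T"
      using card_mono[OF _ T] by simp
    finally show ?thesis .
  qed
  have mono: "set_monom L_col S = m \<longleftrightarrow> card (S - range A_vertex) = e \<and> (\<forall>i. A_vertex i \<in> S \<longleftrightarrow> i \<in> T)"
    if "finite S" for S
    unfolding set_monom_L_col_eq_iff[OF that] by (simp add: e_def free of_bool_eq_iff) metis
  have fin: "finite S" if "independent_set (L_graph n) S" for S
    using that by (auto simp: independent_set_def L_graph_def intro: finite_subset)
  have sub1: "F1 \<subseteq> {S. independent_set (L_graph n) S \<and> set_monom L_col S = m}"
  proof
    fix S assume "S \<in> F1"
    then obtain U where U: "U \<subseteq> V" "card U = e" and S: "S = A_vertex ` T \<union> U"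
      by (auto simp: F1_def)
    have "independent_set (L_graph n) S"
      unfolding independent_set_L_graph S using U(1) T by (auto simp: V_def L_graph_def)
    moreover have "S - range A_vertex = U" using U(1) V(2) by (auto simp: S)
    moreover have "A_vertex i \<in> S \<longleftrightarrow> i \<in> T" for i using U(1) V(2) by (auto simp: S)
    ultimately show "S \<in> {S. independent_set (L_graph n) S \<and> set_monom L_col S = m}"
      using fin U(2) by (simp add: mono)
  qed
  have sub2: "F2 \<subseteq> {S. independent_set (L_graph n) S \<and> set_monom L_col S = m}"
  proof
    fix S assume "S \<in> F2"
    then have T0: "T = {}" and e: "e > 0" by (auto simp: F2_def split: if_splits)
    with \<open>S \<in> F2\<close> obtain U where U: "U \<subseteq> B_vertex ` {1..n}" "card U = e - 1" and S: "S = insert Centre U"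
      by (auto simp: F2_def)
    have "independent_set (L_graph n) S"
      unfolding independent_set_L_graph S using U(1) by (auto simp: L_graph_def)
    moreover have "S - range A_vertex = insert Centre U" using U(1) by (auto simp: S)
    moreover have "card (insert Centre U) = e"
      using U e finite_subset[OF U(1)] by (subst card_insert_disjoint) auto
    moreover have "A_vertex i \<notin> S" for i using U(1) by (auto simp: S)
    ultimately show "S \<in> {S. independent_set (L_graph n) S \<and> set_monom L_col S = m}"
      using fin T0 by (simp add: mono)
  qed
  have "{S. independent_set (L_graph n) S \<and> set_monom L_col S = m} \<subseteq> F1 \<union> F2"
  proof safe
    fix S assume ind: "independent_set (L_graph n) S" and m: "m = set_monom L_col S" and "S \<notin> F2"
    from mono[OF fin[OF ind]] m have card: "card (S - range A_vertex) = e"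
      and A: "\<And>i. A_vertex i \<in> S \<longleftrightarrow> i \<in> T" by auto
    note ind' = ind[unfolded independent_set_L_graph]
    have range: "Leaf i \<in> S \<Longrightarrow> i \<in> {1..n}" "B_vertex i \<in> S \<Longrightarrow> i \<in> {1..n}" for i
      using ind' by (auto simp: L_graph_def)
    have "Centre \<notin> S"
    proof
      assume C: "Centre \<in> S"
      have "T = {}" using ind' C T A by blast
      have S: "S - {Centre} \<subseteq> B_vertex ` {1..n}"
      proof
        fix v assume v: "v \<in> S - {Centre}"
        show "v \<in> B_vertex ` {1..n}"
        proof (cases v)
          case (Leaf i)
          then have "Leaf i \<in> S" using v by simp
          then show ?thesis using range(1) ind' C by blast
        next
          case (A_vertex i)
          then show ?thesis using v A \<open>T = {}\<close> by simp
        next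
          case (B_vertex i)
          then show ?thesis using v range(2) by blast
        qed (use v in simp)
      qed
      have "S - range A_vertex = S" using A \<open>T = {}\<close> by auto
      then have "card S = e" using card by simp
      have "e > 0" using C fin[OF ind] \<open>card S = e\<close> card_gt_0_iff by blast
      moreover have "card (S - {Centre}) = e - 1"
        using C \<open>card S = e\<close> by simp
      ultimately have "S - {Centre} \<in> {U. U \<subseteq> B_vertex ` {1..n} \<and> card U = e - 1}" "e > 0"
        using S by simp_all
      moreover from this have "F2 = insert Centre ` {U. U \<subseteq> B_vertex ` {1..n} \<and> card U = e - 1}"
        unfolding F2_def using \<open>T = {}\<close> by (simp only: simp_thms if_True)
      ultimately have "insert Centre (S - {Centre}) \<in> F2" by (simp only: imageI)
      with C \<open>S \<notin> F2\<close> show False by (simp add: insert_absorb)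
    qed
    have "S - range A_vertex \<subseteq> V"
    proof
      fix v assume v: "v \<in> S - range A_vertex"
      show "v \<in> V"
      proof (cases v)
        case (B_vertex i)
        then have "B_vertex i \<in> S" using v by simp
        then have "i \<in> {1..n} - T" using range(2) ind' A by blast
        with B_vertex show ?thesis by (simp add: V_def)
      next
        case (Leaf i)
        then have "i \<in> {1..n}" using v range(1) by blast
        with Leaf show ?thesis by (simp add: V_def)
      qed (use v \<open>Centre \<notin> S\<close> in auto)
    qed
    moreover have "S = A_vertex ` T \<union> (S - range A_vertex)" using A by auto
    ultimately show "S \<in> F1" unfolding F1_def using card by blast
  qed
  with sub1 sub2 have eq: "{S. independent_set (L_graph n) S \<and> set_monom L_col S = m} = F1 \<union> F2"
    by blast
  have "finite {U. U \<subseteq> V \<and> card U = e}" using V(1) by simp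
  then have fin1: "finite F1" unfolding F1_def by (rule finite_imageI)
  have "finite {U. U \<subseteq> B_vertex ` {1..n} \<and> card U = e - 1}" by simp
  then have fin2: "finite F2" unfolding F2_def by simp
  have "F1 \<inter> F2 = {}" using V(3) by (auto simp: F1_def F2_def)
  then have "card (F1 \<union> F2) = card F1 + card F2"
    using fin1 fin2 by (simp add: card_Un_disjoint)
  moreover have "card F1 = (2 * n - card T choose e)"
  proof -
    have "inj_on (\<lambda>U. A_vertex ` T \<union> U) {U. U \<subseteq> V \<and> card U = e}"
    proof (rule inj_onI)
      fix U U' assume "U \<in> {U. U \<subseteq> V \<and> card U = e}" "U' \<in> {U. U \<subseteq> V \<and> card U = e}"
        and eq: "A_vertex ` T \<union> U = A_vertex ` T \<union> U'"
      then have "U = (A_vertex ` T \<union> U) - range A_vertex" "U' = (A_vertex ` T \<union> U') - range A_vertex"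
        using V(2) by auto
      with eq show "U = U'" by simp
    qed
    then show ?thesis
      unfolding F1_def using n_subsets[OF V(1)] by (simp add: card_image cardV)
  qed
  moreover have "card F2 = (if card T = 0 \<and> e > 0 then n choose (e - 1) else 0)"
  proof -
    have "inj_on (insert Centre) {U. U \<subseteq> B_vertex ` {1..n} \<and> card U = e - 1}"
    proof (rule inj_onI)
      fix U U' assume "U \<in> {U. U \<subseteq> B_vertex ` {1..n} \<and> card U = e - 1}"
          "U' \<in> {U. U \<subseteq> B_vertex ` {1..n} \<and> card U = e - 1}"
        and eq: "insert Centre U = insert Centre U'"
      then have "Centre \<notin> U" "Centre \<notin> U'" by auto
      with eq show "U = U'" by (simp add: insert_ident)
    qed
    moreover have "card (B_vertex ` {1..n}) = n" by (subst card_image) (auto simp: inj_on_def)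
    ultimately show ?thesis
      using n_subsets[of "B_vertex ` {1..n}" "e - 1"] finT
      by (simp add: F2_def card_image)
  qed
  ultimately show ?thesis
    unfolding eq by (simp add: L_coeff_def e_def)
qed

lemma lookup_coloured_independence_poly_L_graph:
  "Poly_Mapping.lookup (coloured_independence_poly (L_graph n)) m =
    (if (\<forall>i. Poly_Mapping.lookup m (Free i) \<le> of_bool (i \<in> {1..n}))
     then real (L_coeff n (\<Sum>i\<in>{1..n}. Poly_Mapping.lookup m (Free i)) (Poly_Mapping.lookup m Bound)) else 0)"
proof -
  have fin: "finite (verts (L_graph n))" by (simp add: L_graph_def)
  have col: "colour (L_graph n) = L_col" by (simp add: L_graph_def)
  show ?thesis
  proof (cases "\<forall>i. Poly_Mapping.lookup m (Free i) \<le> of_bool (i \<in> {1..n})")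
    case True
    define T where "T = {i. Poly_Mapping.lookup m (Free i) \<noteq> 0}"
    have T: "T \<subseteq> {1..n}"
    proof
      fix i assume "i \<in> T"
      with True[rule_format, of i] show "i \<in> {1..n}" by (auto simp: T_def of_bool_def split: if_splits)
    qed
    have free: "Poly_Mapping.lookup m (Free i) = of_bool (i \<in> T)" for i
      using True[rule_format, of i] by (auto simp: T_def of_bool_def split: if_splits)
    have "(\<Sum>i\<in>{1..n}. Poly_Mapping.lookup m (Free i)) = card T"
      using T by (simp add: free of_bool_def Int_absorb1 flip: sum.inter_restrict)
    with True show ?thesis
      by (simp add: lookup_coloured_independence_poly[OF fin] col card_independent_sets_L_graph[OF T free])
  next
    case False
    then obtain i where i: "\<not> Poly_Mapping.lookup m (Free i) \<le> of_bool (i \<in> {1..n})" by blast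
    have "\<not> (independent_set (L_graph n) S \<and> set_monom L_col S = m)" for S
    proof
      assume S: "independent_set (L_graph n) S \<and> set_monom L_col S = m"
      then have sub: "S \<subseteq> verts (L_graph n)" by (simp add: independent_set_def)
      with fin have "finite S" by (rule finite_subset[rotated])
      with S have "Poly_Mapping.lookup m (Free i) = of_bool (A_vertex i \<in> S)"
        by (simp add: set_monom_L_col_eq_iff)
      with i sub show False by (auto simp: L_graph_def of_bool_def split: if_splits)
    qed
    then have "{S. independent_set (L_graph n) S \<and> set_monom L_col S = m} = {}" by blast
    then have "card {S. independent_set (L_graph n) S \<and> set_monom L_col S = m} = 0"
      by (simp only: card.empty)
    with False show ?thesis
      by (simp only: lookup_coloured_independence_poly[OF fin] col if_False of_nat_0)
  qed
qed


section \<open>The quadratic forms in the interior\<close>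

lemma Suc_times_choose_Suc: "Suc j * (m choose Suc j) = (m - j) * (m choose j)"
  by (metis binomial_absorb_comp binomial_absorption)

text \<open>Each factor \<open>n - i\<close> of the falling factorial is at most half of \<open>2 n - i\<close>. This is the source of all
smallness of the perturbation, whose coefficients are binomials of \<open>n\<close> against those of \<open>2 n\<close>.\<close>

lemma two_power_times_choose_le: "2 ^ j * (n choose j) \<le> (2 * n choose j)"
proof (induction j)
  case (Suc j)
  have "Suc j * (2 ^ Suc j * (n choose Suc j)) = 2 * (n - j) * (2 ^ j * (n choose j))"
    using Suc_times_choose_Suc[of j n] by (metis (no_types) mult.assoc mult.left_commute power_Suc)
  also have "\<dots> \<le> (2 * n - j) * (2 * n choose j)"
    by (intro mult_mono Suc.IH) auto
  also have "\<dots> = Suc j * (2 * n choose Suc j)"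
    by (rule Suc_times_choose_Suc[symmetric])
  finally show ?case by (simp only: Suc_mult_le_cancel1)
qed simp

text \<open>This and the two bounds that follow compare the perturbation in the coefficients of \<open>x y\<close>, \<open>x\<^sup>2\<close> and \<open>y\<^sup>2\<close> of
the form with the slack of the unperturbed form; in the application \<open>a = \<alpha> + 1\<close> and \<open>b = \<beta> + 1\<close>.\<close>

lemma perturbation_bound_mixed:
  assumes "a + b = 2 * n" "a > 0" "b > 0"
  shows "(n choose (a - 1)) * (2 * n - 1) < 2 * (2 * n choose a)"
proof (cases "a - 1 \<le> n")
  case True
  have pos: "(2 * n choose (a - 1)) > 0" using assms by simp
  have "a * ((n choose (a - 1)) * (2 * n - 1)) \<le> 2 ^ (a - 1) * ((n choose (a - 1)) * (2 * n - 1))"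
    using less_exp[of "a - 1"] assms by (intro mult_right_mono) linarith+
  also have "\<dots> \<le> (2 * n choose (a - 1)) * (2 * n - 1)"
    using mult_right_mono[OF two_power_times_choose_le[of "a - 1" n], of "2 * n - 1"]
    by (simp add: mult_ac)
  also have "\<dots> < (2 * n choose (a - 1)) * (2 * (b + 1))"
    using True assms pos by (intro mult_strict_left_mono) auto
  also have "\<dots> = a * (2 * (2 * n choose a))"
  proof -
    have "a * (2 * n choose a) = (b + 1) * (2 * n choose (a - 1))"
      using Suc_times_choose_Suc[of "a - 1" "2 * n"] assms(2) by (simp flip: assms(1))
    then show ?thesis by (simp only: mult_ac)
  qed
  finally show ?thesis by (simp only: mult_less_cancel1)
next
  case False
  then have "n choose (a - 1) = 0" by (simp add: binomial_eq_0)
  moreover have "2 * n choose a > 0" using assms by simp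
  ultimately show ?thesis by (simp only: mult_0)
qed

lemma perturbation_bound_first:
  assumes "a + b = 2 * n" "a > 0" "b > 0"
  shows "(n choose a) * (a * (a + 1)) \<le> (2 * n choose a) * b"
proof (cases "a \<le> n")
  case True
  have "(n choose a) * (a * (a + 1)) \<le> (n choose a) * (b * 2 ^ a)"
    using True assms less_exp[of a] by (intro mult_left_mono mult_mono) (auto simp: Suc_le_eq)
  also have "\<dots> \<le> (2 * n choose a) * b"
    using mult_right_mono[OF two_power_times_choose_le[of a n], of b] by (simp add: mult_ac)
  finally show ?thesis .
qed (simp add: binomial_eq_0)

lemma perturbation_bound_last:
  assumes "Suc (Suc j) + b = 2 * n" "b > 0"
  shows "(n choose j) * (b * (b + 1)) < (2 * n choose Suc (Suc j)) * Suc (Suc j)"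
proof -
  have "Suc j * ((n choose j) * (b * (b + 1))) = (Suc j * (n choose j)) * (b * (b + 1))"
    by (simp only: mult_ac)
  also have "\<dots> \<le> (2 ^ j * (n choose j)) * (b * (b + 1))"
    using less_exp[of j] by (intro mult_right_mono) (auto simp: Suc_le_eq)
  also have "\<dots> \<le> (2 * n choose j) * (b * (b + 1))"
    by (intro mult_right_mono two_power_times_choose_le) auto
  also have "\<dots> < (2 * n choose j) * ((b + 2) * (b + 1))"
    using assms by (intro mult_strict_left_mono mult_strict_right_mono) auto
  also have "\<dots> = (2 * n - Suc j) * ((2 * n - j) * (2 * n choose j))"
  proof -
    have "2 * n - Suc j = b + 1" "2 * n - j = b + 2" using assms(1) by linarith+
    then show ?thesis by (simp only: mult_ac)
  qed
  also have "\<dots> = (2 * n - Suc j) * (Suc j * (2 * n choose Suc j))"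
    by (simp only: Suc_times_choose_Suc)
  also have "\<dots> = Suc j * ((2 * n choose Suc (Suc j)) * Suc (Suc j))"
    using Suc_times_choose_Suc[of "Suc j" "2 * n"] by (simp only: mult_ac)
  finally show ?thesis by (simp only: mult_less_cancel1)
qed

text \<open>The quadratic form of a Hessian that is symmetric in the \<open>z\<^sub>i\<close> and has no \<open>z\<^sub>i\<^sup>2\<close>: here \<open>s\<close> is the sum of the
\<open>z\<^sub>i\<close> and \<open>Q\<close> the sum of their squares, so \<open>s\<^sup>2 - Q\<close> is the sum of \<open>z\<^sub>i z\<^sub>j\<close> over ordered pairs with
\<open>i \<noteq> j\<close>.\<close>

definition ternary_form ::
  "real \<Rightarrow> real \<Rightarrow> real \<Rightarrow> real \<Rightarrow> real \<Rightarrow> real \<Rightarrow> real \<Rightarrow> real \<Rightarrow> real \<Rightarrow> real \<Rightarrow> real" where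
  "ternary_form A E F p q r X Y s Q =
     A * X\<^sup>2 + 2 * E * (X * Y) + F * Y\<^sup>2 + 2 * (p * X + q * Y) * s + r * (s\<^sup>2 - Q)"

lemma ternary_form_rescale:
  assumes "K > 0" "L > 0" "a > 0" "b > 0"
  shows "ternary_form (f * (K * (K + 1)) * cA) (f * (K * L) * cE) (f * (L * (L + 1)) * cF)
       (f * K * p) (f * L * q) (f * r) X Y s Q =
     f * ternary_form ((1 + 1 / K) * (cA * a\<^sup>2)) (cE * (a * b)) ((1 + 1 / L) * (cF * b\<^sup>2))
       (p * a) (q * b) r (K * X / a) (L * Y / b) s Q"
  using assms by (simp add: ternary_form_def field_simps power2_eq_square)

text \<open>If \<open>A\<close>, \<open>F\<close> and \<open>Q\<close> attain their bounds, the form is \<open>r (N - 1) / N\<close> times the square of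
\<open>N (x + y) + s\<close>.\<close>

lemma ternary_form_nonpos_unperturbed:
  fixes N r :: real
  assumes "N > 1" "r \<ge> 0"
    and AF: "A \<le> r * (N * (N - 1))" "F \<le> r * (N * (N - 1))"
    and Q: "Q \<ge> s\<^sup>2 / N" and hyp: "N * (x + y) + s = 0"
  shows "ternary_form A (r * (N * (N - 1))) F (r * (N - 1)) (r * (N - 1)) r x y s Q \<le> 0"
proof -
  have s: "s = - N * (x + y)" using hyp by linarith
  have Q': "Q \<ge> N * (x + y)\<^sup>2"
    using Q assms(1) unfolding s by (simp add: power_mult_distrib) (simp add: power2_eq_square)
  have "ternary_form A (r * (N * (N - 1))) F (r * (N - 1)) (r * (N - 1)) r x y s Q \<le>
      ternary_form (r * (N * (N - 1))) (r * (N * (N - 1))) (r * (N * (N - 1))) (r * (N - 1)) (r * (N - 1)) r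
        x y s (N * (x + y)\<^sup>2)"
  proof -
    have "A * x\<^sup>2 \<le> r * (N * (N - 1)) * x\<^sup>2" "F * y\<^sup>2 \<le> r * (N * (N - 1)) * y\<^sup>2"
      using AF by (auto intro: mult_right_mono)
    moreover have "r * (s\<^sup>2 - Q) \<le> r * (s\<^sup>2 - N * (x + y)\<^sup>2)"
      using Q' assms(2) by (intro mult_left_mono) auto
    ultimately show ?thesis unfolding ternary_form_def by linarith
  qed
  also have "\<dots> = 0"
    unfolding ternary_form_def s by (simp add: power2_eq_square algebra_simps)
  finally show ?thesis .
qed

text \<open>The stronger lower bound on \<open>Q\<close> contributes an additional \<open>- r N (x + y)\<^sup>2\<close> on the hyperplane. What is left is a binary
form in \<open>x\<close> and \<open>y\<close>, with matrix entries \<open>A - r N\<^sup>2\<close>, \<open>E - r N\<^sup>2\<close> and \<open>F - r N\<^sup>2\<close>, which is nonpositive by diagonal dominance.\<close>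

lemma ternary_form_nonpos_perturbed:
  fixes N r :: real
  assumes "N > 1" "r \<ge> 0"
    and A: "A + \<bar>E - r * N\<^sup>2\<bar> \<le> r * N\<^sup>2" and F: "F + \<bar>E - r * N\<^sup>2\<bar> \<le> r * N\<^sup>2"
    and Q: "Q \<ge> 2 * s\<^sup>2 / N" and hyp: "N * (x + y) + s = 0"
  shows "ternary_form A E F (r * (N - 1)) (r * (N - 1)) r x y s Q \<le> 0"
proof -
  define D where "D = E - r * N\<^sup>2"
  have s: "s = - N * (x + y)" using hyp by linarith
  have Q': "Q \<ge> 2 * N * (x + y)\<^sup>2"
    using Q assms(1) unfolding s by (simp add: power_mult_distrib) (simp add: power2_eq_square)
  have "2 * D * (x * y) \<le> \<bar>D\<bar> * (x\<^sup>2 + y\<^sup>2)"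
  proof -
    have "2 * D * (x * y) \<le> \<bar>D\<bar> * \<bar>2 * (x * y)\<bar>"
      by (metis abs_ge_self abs_mult mult.assoc mult.left_commute)
    also have "\<bar>2 * (x * y)\<bar> \<le> x\<^sup>2 + y\<^sup>2"
      using sum_squares_bound[of x y] sum_squares_bound[of x "- y"] by (simp add: abs_le_iff)
    finally show ?thesis by (simp add: mult_left_mono)
  qed
  moreover have "A * x\<^sup>2 \<le> (r * N\<^sup>2 - \<bar>D\<bar>) * x\<^sup>2" "F * y\<^sup>2 \<le> (r * N\<^sup>2 - \<bar>D\<bar>) * y\<^sup>2"
    using A F by (intro mult_right_mono; simp add: D_def)+
  moreover have "r * (s\<^sup>2 - Q) \<le> r * (s\<^sup>2 - 2 * N * (x + y)\<^sup>2)"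
    using Q' assms(2) by (intro mult_left_mono) auto
  ultimately have "ternary_form A E F (r * (N - 1)) (r * (N - 1)) r x y s Q \<le>
      (r * N\<^sup>2 - \<bar>D\<bar>) * x\<^sup>2 + 2 * (r * N\<^sup>2) * (x * y) + \<bar>D\<bar> * (x\<^sup>2 + y\<^sup>2) + (r * N\<^sup>2 - \<bar>D\<bar>) * y\<^sup>2
       + 2 * (r * (N - 1) * x + r * (N - 1) * y) * s + r * (s\<^sup>2 - 2 * N * (x + y)\<^sup>2)"
    unfolding ternary_form_def D_def by (simp add: algebra_simps)
  also have "\<dots> = 0"
    unfolding s by (simp add: power2_eq_square algebra_simps)
  finally show ?thesis .
qed

lemma absorbed_square:
  assumes "C * (a + 1) * a = R" "(a::real) > 0"
  shows "C * a\<^sup>2 = R * (a / (a + 1))"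
  using assms(2) unfolding assms(1)[symmetric] by (simp add: power2_eq_square)

text \<open>After substituting \<open>X = a x\<close> and \<open>Y = b y\<close>, all binomials in an unperturbed form are simple multiples of
the smallest one, \<open>r\<close>.\<close>

lemma interior_binomials:
  fixes \<alpha> \<beta> :: nat
  defines "a \<equiv> real (Suc \<alpha>)" and "b \<equiv> real (Suc \<beta>)" and "N \<equiv> real (\<alpha> + \<beta> + 2)"
    and "r \<equiv> real (\<alpha> + \<beta> choose \<alpha>)"
  shows "real (Suc (\<alpha> + \<beta>) choose Suc \<alpha>) * a = r * (N - 1)"
    and "real (Suc (\<alpha> + \<beta>) choose \<alpha>) * b = r * (N - 1)"
    and "real (Suc (Suc (\<alpha> + \<beta>)) choose Suc \<alpha>) * (a * b) = r * (N * (N - 1))"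
    and "real (Suc (Suc (\<alpha> + \<beta>)) choose Suc (Suc \<alpha>)) * a\<^sup>2 = r * (N * (N - 1)) * (a / (a + 1))"
    and "real (Suc (Suc (\<alpha> + \<beta>)) choose \<alpha>) * b\<^sup>2 = r * (N * (N - 1)) * (b / (b + 1))"
proof -
  have absorb: "real (Suc m choose Suc j) * real (Suc j) = real (Suc m) * real (m choose j)" for m j
    using Suc_times_binomial_eq[of m j] by (metis of_nat_mult)
  have pos: "a > 0" "b > 0" by (simp_all add: a_def b_def)
  have N1: "N - 1 = real (Suc (\<alpha> + \<beta>))" "N = real (Suc (Suc (\<alpha> + \<beta>)))"
    by (simp_all add: N_def)
  show p: "real (Suc (\<alpha> + \<beta>) choose Suc \<alpha>) * a = r * (N - 1)"
    unfolding a_def r_def N1(1) absorb by (rule mult.commute)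
  have "Suc (\<alpha> + \<beta>) choose \<alpha> = (Suc (\<alpha> + \<beta>) choose Suc \<beta>)" "\<alpha> + \<beta> choose \<alpha> = (\<alpha> + \<beta> choose \<beta>)"
    using binomial_symmetric[of \<alpha> "Suc (\<alpha> + \<beta>)"] binomial_symmetric[of \<alpha> "\<alpha> + \<beta>"] by simp_all
  then show q: "real (Suc (\<alpha> + \<beta>) choose \<alpha>) * b = r * (N - 1)"
    unfolding b_def r_def N1(1) by (simp only: absorb) (rule mult.commute)
  have "real (Suc (Suc (\<alpha> + \<beta>)) choose Suc \<alpha>) * a = N * real (Suc (\<alpha> + \<beta>) choose \<alpha>)"
    unfolding a_def N1(2) by (rule absorb)
  with q show "real (Suc (Suc (\<alpha> + \<beta>)) choose Suc \<alpha>) * (a * b) = r * (N * (N - 1))"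
    by (metis mult.assoc mult.left_commute)
  have "real (Suc (Suc (\<alpha> + \<beta>)) choose Suc (Suc \<alpha>)) * (a + 1) = N * real (Suc (\<alpha> + \<beta>) choose Suc \<alpha>)"
    unfolding N1(2) using absorb[of "Suc (\<alpha> + \<beta>)" "Suc \<alpha>"] by (simp add: a_def add_ac)
  then have "real (Suc (Suc (\<alpha> + \<beta>)) choose Suc (Suc \<alpha>)) * (a + 1) * a = r * (N * (N - 1))"
    using p by (metis mult.assoc mult.left_commute)
  then show "real (Suc (Suc (\<alpha> + \<beta>)) choose Suc (Suc \<alpha>)) * a\<^sup>2 = r * (N * (N - 1)) * (a / (a + 1))"
    using pos(1) by (rule absorbed_square)
  have "Suc (Suc (\<alpha> + \<beta>)) choose \<alpha> = (Suc (Suc (\<alpha> + \<beta>)) choose Suc (Suc \<beta>))"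
    "Suc (\<alpha> + \<beta>) choose \<alpha> = (Suc (\<alpha> + \<beta>) choose Suc \<beta>)"
    using binomial_symmetric[of \<alpha> "Suc (Suc (\<alpha> + \<beta>))"] binomial_symmetric[of \<alpha> "Suc (\<alpha> + \<beta>)"]
    by simp_all
  then have "real (Suc (Suc (\<alpha> + \<beta>)) choose \<alpha>) * (b + 1) = N * real (Suc (\<alpha> + \<beta>) choose \<alpha>)"
    unfolding N1(2) using absorb[of "Suc (\<alpha> + \<beta>)" "Suc \<beta>"] by (simp add: b_def add_ac)
  then have "real (Suc (Suc (\<alpha> + \<beta>)) choose \<alpha>) * (b + 1) * b = r * (N * (N - 1))"
    using q by (metis mult.assoc mult.left_commute)
  then show "real (Suc (Suc (\<alpha> + \<beta>)) choose \<alpha>) * b\<^sup>2 = r * (N * (N - 1)) * (b / (b + 1))"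
    using pos(2) by (rule absorbed_square)
qed

lemma succ_ratio_le:
  assumes "(K::real) \<ge> a" "a > 0" "c \<ge> 0"
  shows "(1 + 1 / K) * (c * (a / (a + 1))) \<le> c"
proof -
  have "1 / K \<le> 1 / a" using assms by (intro divide_left_mono) auto
  then have "(1 + 1 / K) * (a / (a + 1)) \<le> (1 + 1 / a) * (a / (a + 1))"
    using assms(2) by (intro mult_right_mono) auto
  also have "\<dots> = 1"
  proof -
    have "1 + 1 / a = (a + 1) / a" using assms(2) by (simp add: add_divide_distrib)
    then show ?thesis using assms(2) by simp
  qed
  finally have "c * ((1 + 1 / K) * (a / (a + 1))) \<le> c * 1"
    using assms(3) by (rule mult_left_mono)
  then show ?thesis by (simp only: mult_ac mult_1_right)
qed

text \<open>The Hessian form for a derivative of order \<open>I\<close> in \<open>x\<close> and \<open>J\<close> in \<open>y\<close>: the remaining parameters are plain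
coefficients of the polynomial, and differentiation multiplies them by these factorials.\<close>

definition kernel_form ::
  "nat \<Rightarrow> nat \<Rightarrow> real \<Rightarrow> real \<Rightarrow> real \<Rightarrow> real \<Rightarrow> real \<Rightarrow> real \<Rightarrow> real \<Rightarrow> real \<Rightarrow> real \<Rightarrow> real \<Rightarrow> real" where
  "kernel_form I J cA cE cF p q r =
     ternary_form (fact (I + 2) * fact J * cA) (fact (I + 1) * fact (J + 1) * cE)
       (fact I * fact (J + 2) * cF) (fact (I + 1) * fact J * p) (fact I * fact (J + 1) * q)
       (fact I * fact J * r)"

text \<open>Scaling \<open>X\<close> by \<open>I + 1\<close> and \<open>Y\<close> by \<open>J + 1\<close> absorbs the factorials except for the factors \<open>1 + 1 / (I + 1)\<close>
and \<open>1 + 1 / (J + 1)\<close>, which tend to \<open>1\<close> as \<open>I\<close> and \<open>J\<close> grow: this is the effect of multiplying by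
a high power of \<open>x y\<close>.\<close>

lemma kernel_form_rescale:
  assumes "a > 0" "b > 0"
  shows "kernel_form I J cA cE cF p q r X Y s Q =
     fact I * fact J * ternary_form ((1 + 1 / real (I + 1)) * (cA * a\<^sup>2)) (cE * (a * b))
       ((1 + 1 / real (J + 1)) * (cF * b\<^sup>2)) (p * a) (q * b) r
       (real (I + 1) * X / a) (real (J + 1) * Y / b) s Q"
proof -
  have f: "fact (I + 2) = (real (I + 2) * real (I + 1)) * fact I" for I
    by (simp add: algebra_simps)
  have f': "fact (I + 1) = real (I + 1) * fact I" for I by simp
  show ?thesis
    unfolding kernel_form_def f f'
    by (subst ternary_form_rescale[symmetric])
      (use assms in \<open>simp_all add: ternary_form_def algebra_simps\<close>)
qed

text \<open>The diagonal coefficients carry the factor \<open>(1 + 1 / (k + a)) * a / (a + 1)\<close>, which is at most \<open>1\<close> for every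
\<open>k\<close>; so the unperturbed estimate applies for every \<open>k\<close>.\<close>

lemma kernel_form_unperturbed_nonpos:
  fixes k \<alpha> \<beta> :: nat
  defines "N \<equiv> real (\<alpha> + \<beta> + 2)"
  assumes Q: "Q \<ge> s\<^sup>2 / N"
    and hyp: "N * (real (k + \<alpha> + 1) * X / real (Suc \<alpha>) + real (k + \<beta> + 1) * Y / real (Suc \<beta>)) + s = 0"
  shows "kernel_form (k + \<alpha>) (k + \<beta>) (real (Suc (Suc (\<alpha> + \<beta>)) choose Suc (Suc \<alpha>)))
     (real (Suc (Suc (\<alpha> + \<beta>)) choose Suc \<alpha>)) (real (Suc (Suc (\<alpha> + \<beta>)) choose \<alpha>))
     (real (Suc (\<alpha> + \<beta>) choose Suc \<alpha>)) (real (Suc (\<alpha> + \<beta>) choose \<alpha>))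
     (real (\<alpha> + \<beta> choose \<alpha>)) X Y s Q \<le> 0"
proof -
  have pos: "real (Suc \<alpha>) > 0" "real (Suc \<beta>) > 0" by simp_all
  let ?r = "real (\<alpha> + \<beta> choose \<alpha>)"
  have N1: "N > 1" by (simp add: N_def)
  then have rN: "?r * (N * (N - 1)) \<ge> 0" by simp
  show ?thesis
    unfolding kernel_form_rescale[OF pos] interior_binomials[of \<alpha> \<beta>, folded N_def]
  proof (rule mult_nonneg_nonpos)
    show "ternary_form
      ((1 + 1 / real (k + \<alpha> + 1)) * (?r * (N * (N - 1)) * (real (Suc \<alpha>) / (real (Suc \<alpha>) + 1))))
      (?r * (N * (N - 1)))
      ((1 + 1 / real (k + \<beta> + 1)) * (?r * (N * (N - 1)) * (real (Suc \<beta>) / (real (Suc \<beta>) + 1))))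
      (?r * (N - 1)) (?r * (N - 1)) ?r
      (real (k + \<alpha> + 1) * X / real (Suc \<alpha>)) (real (k + \<beta> + 1) * Y / real (Suc \<beta>)) s Q \<le> 0"
      by (rule ternary_form_nonpos_unperturbed[OF N1 _ _ _ Q hyp]; (rule succ_ratio_le[OF _ _ rN])?; simp)
  qed simp
qed

text \<open>The estimate needed when no \<open>z\<^sub>i\<close> has been differentiated. In the first three coefficients the second
summand counts independent sets that contain the centre.\<close>

definition perturbed_form_nonpos :: "nat \<Rightarrow> nat \<Rightarrow> nat \<Rightarrow> nat \<Rightarrow> bool" where
  "perturbed_form_nonpos n k \<alpha> \<beta> \<longleftrightarrow> (\<forall>X Y s Q. Q \<ge> s\<^sup>2 / real n \<longrightarrow>
    real (2 * n) * (real (k + \<alpha> + 1) * X / real (Suc \<alpha>) + real (k + \<beta> + 1) * Y / real (Suc \<beta>)) + s = 0 \<longrightarrow>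
    kernel_form (k + \<alpha>) (k + \<beta>)
     (real (Suc (Suc (\<alpha> + \<beta>)) choose Suc (Suc \<alpha>)) + real (n choose Suc \<alpha>))
     (real (Suc (Suc (\<alpha> + \<beta>)) choose Suc \<alpha>) + real (n choose \<alpha>))
     (real (Suc (Suc (\<alpha> + \<beta>)) choose \<alpha>) + real (if \<alpha> = 0 then 0 else n choose (\<alpha> - 1)))
     (real (Suc (\<alpha> + \<beta>) choose Suc \<alpha>)) (real (Suc (\<alpha> + \<beta>) choose \<alpha>))
     (real (\<alpha> + \<beta> choose \<alpha>)) X Y s Q \<le> 0)"

text \<open>In the limit \<open>k \<rightarrow> \<infinity>\<close> the diagonal dominance required by \<open>ternary_form_nonpos_perturbed\<close> holds strictly,
hence it holds for large \<open>k\<close>. Strictness is where the three bounds on the perturbation enter. In the row of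
\<open>x\<close> the diagonal bound may be an equality (it is for \<open>n = 1\<close>), but then the mixed perturbation \<open>dE\<close> is
nonzero and the off-diagonal entry gives the slack.\<close>

lemma perturbed_form_nonpos_eventually:
  fixes n \<alpha> \<beta> :: nat
  assumes n: "\<alpha> + \<beta> + 2 = 2 * n"
  shows "\<forall>\<^sub>F k in sequentially. perturbed_form_nonpos n k \<alpha> \<beta>"
proof -
  define a where "a = real (Suc \<alpha>)"
  define b where "b = real (Suc \<beta>)"
  define N where "N = real (\<alpha> + \<beta> + 2)"
  define r where "r = real (\<alpha> + \<beta> choose \<alpha>)"
  define dA where "dA = real (n choose Suc \<alpha>)"
  define dE where "dE = real (n choose \<alpha>)"
  define dF where "dF = real (if \<alpha> = 0 then 0 else n choose (\<alpha> - 1))"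
  define M where "M = real (2 * n choose Suc \<alpha>)"
  define cA where "cA = real (Suc (Suc (\<alpha> + \<beta>)) choose Suc (Suc \<alpha>)) + dA"
  define cE where "cE = real (Suc (Suc (\<alpha> + \<beta>)) choose Suc \<alpha>) + dE"
  define cF where "cF = real (Suc (Suc (\<alpha> + \<beta>)) choose \<alpha>) + dF"
  have pos: "a > 0" "b > 0" and N1: "N > 1" and r0: "r \<ge> 0"
    by (simp_all add: a_def b_def N_def r_def)
  have N2n: "N = real (2 * n)" "N = 2 * real n" using n by (simp_all add: N_def)
  have n2: "Suc (Suc (\<alpha> + \<beta>)) = 2 * n" using n by simp
  note binom = interior_binomials[of \<alpha> \<beta>, folded N_def a_def b_def r_def]
  have M: "M * (a * b) = r * (N * (N - 1))" using binom(3) by (simp only: M_def n2)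
  have dE2: "dE * (a * b) < 2 * (r * N)"
  proof -
    have "dE * (N - 1) < 2 * M"
    proof -
      have "real ((n choose \<alpha>) * (2 * n - 1)) < real (2 * (2 * n choose Suc \<alpha>))"
        using perturbation_bound_mixed[of "Suc \<alpha>" "Suc \<beta>" n] n by (intro of_nat_less_iff[THEN iffD2]) simp
      moreover have "real (2 * n - 1) = N - 1" using N1 by (simp add: N2n of_nat_diff)
      ultimately show ?thesis by (simp only: of_nat_mult of_nat_numeral dE_def M_def)
    qed
    then have "dE * (N - 1) * (a * b) < 2 * M * (a * b)"
      using pos by (intro mult_strict_right_mono) auto
    also have "\<dots> = 2 * (r * N) * (N - 1)" using M by simp
    finally have "(dE * (a * b)) * (N - 1) < 2 * (r * N) * (N - 1)" by (simp only: mult_ac)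
    then show ?thesis using N1 by simp
  qed
  have dA2: "dA * a\<^sup>2 \<le> r * (N * (N - 1)) * (1 / (a + 1))"
  proof -
    have "real ((n choose Suc \<alpha>) * (Suc \<alpha> * (Suc \<alpha> + 1))) \<le> real ((2 * n choose Suc \<alpha>) * Suc \<beta>)"
      using perturbation_bound_first[of "Suc \<alpha>" "Suc \<beta>" n] n by (intro of_nat_mono) simp
    then have "dA * (a * (a + 1)) \<le> M * b"
      by (simp only: dA_def M_def a_def b_def of_nat_mult of_nat_add of_nat_1)
    then have "dA * (a * (a + 1)) * a \<le> M * b * a"
      using pos by (intro mult_right_mono) auto
    then have "dA * a\<^sup>2 * (a + 1) \<le> r * (N * (N - 1))"
      using M by (simp add: power2_eq_square mult_ac)
    then show ?thesis using pos by (simp add: pos_le_divide_eq)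
  qed
  have dF2: "dF * b\<^sup>2 < r * (N * (N - 1)) * (1 / (b + 1))"
  proof -
    have "dF * (b * (b + 1)) < M * a"
    proof (cases \<alpha>)
      case 0
      then show ?thesis using n by (simp add: dF_def M_def a_def)
    next
      case (Suc j)
      have "real ((n choose j) * (Suc \<beta> * (Suc \<beta> + 1))) < real ((2 * n choose Suc (Suc j)) * Suc (Suc j))"
        using perturbation_bound_last[of j "Suc \<beta>" n] n Suc by (intro of_nat_less_iff[THEN iffD2]) simp
      then show ?thesis using Suc
        by (simp only: dF_def M_def a_def b_def of_nat_mult of_nat_add of_nat_1) simp
    qed
    then have "dF * (b * (b + 1)) * b < M * a * b"
      using pos by (intro mult_strict_right_mono) auto
    then have "dF * b\<^sup>2 * (b + 1) < r * (N * (N - 1))"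
      using M by (simp add: power2_eq_square mult_ac)
    then show ?thesis using pos by (simp add: pos_less_divide_eq)
  qed
  have E: "cE * (a * b) - r * N\<^sup>2 = dE * (a * b) - r * N"
    using binom(3) by (simp add: cE_def algebra_simps power2_eq_square)
  have dE0: "dE * (a * b) \<ge> 0" using pos by (simp add: dE_def)
  have frac: "r * (N * (N - 1)) * (x / (x + 1)) = r * N\<^sup>2 - r * N - r * (N * (N - 1)) * (1 / (x + 1))"
    if "x > 0" for x
    using that by (simp add: field_simps power2_eq_square)
  \<comment> \<open>Either the mixed perturbation vanishes, and then so does \<open>dA\<close>, or the off-diagonal entry is strictly
    smaller than \<open>r * N\<close>.\<close>
  have A: "cA * a\<^sup>2 + \<bar>cE * (a * b) - r * N\<^sup>2\<bar> < r * N\<^sup>2"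
  proof (cases "dE = 0")
    case True
    then have "n < \<alpha>" by (simp add: dE_def binomial_eq_0_iff)
    then have "dA * a\<^sup>2 = 0" by (simp add: dA_def)
    moreover have "r * (N * (N - 1)) * (1 / (a + 1)) > 0"
      using N1 pos by (simp add: r_def)
    moreover have "\<bar>dE * (a * b) - r * N\<bar> = r * N" using True N1 r0 by (simp add: abs_mult)
    ultimately show ?thesis
      using frac[OF pos(1)] binom(4) unfolding E cA_def distrib_right by linarith
  next
    case False
    then have "dE * (a * b) > 0" using pos by (simp add: dE_def)
    then have "\<bar>dE * (a * b) - r * N\<bar> < r * N" using dE2 by linarith
    then show ?thesis
      using frac[OF pos(1)] binom(4) dA2 unfolding E cA_def distrib_right by linarith
  qed
  have F: "cF * b\<^sup>2 + \<bar>cE * (a * b) - r * N\<^sup>2\<bar> < r * N\<^sup>2"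
  proof -
    have "\<bar>dE * (a * b) - r * N\<bar> \<le> r * N" using dE2 dE0 by linarith
    then show ?thesis
      using frac[OF pos(2)] binom(5) dF2 unfolding E cF_def distrib_right by linarith
  qed
  have lim: "(\<lambda>k. (1 + 1 / real (k + j + 1)) * c + d) \<longlonglongrightarrow> c + d" for j :: nat and c d :: real
  proof -
    have "(\<lambda>k. 1 / real (k + (j + 1))) \<longlonglongrightarrow> 0"
      by (rule LIMSEQ_ignore_initial_segment[OF lim_1_over_n])
    then have "(\<lambda>k. (1 + 1 / real (k + (j + 1))) * c + d) \<longlonglongrightarrow> (1 + 0) * c + d"
      by (intro tendsto_intros)
    then show ?thesis by (simp add: add.assoc)
  qed
  have "\<forall>\<^sub>F k in sequentially. (1 + 1 / real (k + \<alpha> + 1)) * (cA * a\<^sup>2) + \<bar>cE * (a * b) - r * N\<^sup>2\<bar> < r * N\<^sup>2"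
    by (rule order_tendstoD(2)[OF lim A])
  moreover have "\<forall>\<^sub>F k in sequentially. (1 + 1 / real (k + \<beta> + 1)) * (cF * b\<^sup>2) + \<bar>cE * (a * b) - r * N\<^sup>2\<bar> < r * N\<^sup>2"
    by (rule order_tendstoD(2)[OF lim F])
  ultimately show ?thesis
    unfolding perturbed_form_nonpos_def N2n(1)[symmetric] dA_def[symmetric] dE_def[symmetric] dF_def[symmetric]
      cA_def[symmetric] cE_def[symmetric] cF_def[symmetric] r_def[symmetric] a_def[symmetric] b_def[symmetric]
  proof eventually_elim
    case (elim k)
    show ?case
    proof (intro allI impI)
      fix X Y s Q
      assume Q: "s\<^sup>2 / real n \<le> Q"
        and hyp: "N * (real (k + \<alpha> + 1) * X / a + real (k + \<beta> + 1) * Y / b) + s = 0"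
      have Q': "2 * s\<^sup>2 / N \<le> Q" using Q by (simp add: N2n(2))
      show "kernel_form (k + \<alpha>) (k + \<beta>) cA cE cF (real (Suc (\<alpha> + \<beta>) choose Suc \<alpha>))
          (real (Suc (\<alpha> + \<beta>) choose \<alpha>)) r X Y s Q \<le> 0"
        unfolding kernel_form_rescale[OF pos] binom(1,2)
        by (rule mult_nonneg_nonpos[OF _ ternary_form_nonpos_perturbed[OF N1 r0 _ _ Q' hyp]])
          (use elim in auto)
    qed
  qed
qed

definition perturbed_forms_nonpos :: "nat \<Rightarrow> nat \<Rightarrow> bool" where
  "perturbed_forms_nonpos n k \<longleftrightarrow> (\<forall>\<alpha> \<beta>. \<alpha> + \<beta> + 2 = 2 * n \<longrightarrow> perturbed_form_nonpos n k \<alpha> \<beta>)"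

lemma perturbed_forms_nonposD:
  assumes "perturbed_forms_nonpos n k" "\<alpha> + \<beta> + 2 = 2 * n" "Q \<ge> s\<^sup>2 / real n"
    "real (2 * n) * (real (k + \<alpha> + 1) * X / real (Suc \<alpha>) + real (k + \<beta> + 1) * Y / real (Suc \<beta>)) + s = 0"
  shows "kernel_form (k + \<alpha>) (k + \<beta>)
     (real (Suc (Suc (\<alpha> + \<beta>)) choose Suc (Suc \<alpha>)) + real (n choose Suc \<alpha>))
     (real (Suc (Suc (\<alpha> + \<beta>)) choose Suc \<alpha>) + real (n choose \<alpha>))
     (real (Suc (Suc (\<alpha> + \<beta>)) choose \<alpha>) + real (if \<alpha> = 0 then 0 else n choose (\<alpha> - 1)))
     (real (Suc (\<alpha> + \<beta>) choose Suc \<alpha>)) (real (Suc (\<alpha> + \<beta>) choose \<alpha>))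
     (real (\<alpha> + \<beta> choose \<alpha>)) X Y s Q \<le> 0"
  using assms unfolding perturbed_forms_nonpos_def perturbed_form_nonpos_def by blast

lemma ex_perturbed_forms_nonpos:
  assumes "n > 0"
  shows "\<exists>k. perturbed_forms_nonpos n k"
proof -
  have "\<forall>\<^sub>F k in sequentially. \<forall>\<alpha>\<in>{..2 * n - 2}. perturbed_form_nonpos n k \<alpha> (2 * n - 2 - \<alpha>)"
  proof (intro eventually_ball_finite ballI)
    fix \<alpha> assume "\<alpha> \<in> {..2 * n - 2}"
    then have "\<alpha> + (2 * n - 2 - \<alpha>) + 2 = 2 * n" using assms by auto
    then show "\<forall>\<^sub>F k in sequentially. perturbed_form_nonpos n k \<alpha> (2 * n - 2 - \<alpha>)"
      by (rule perturbed_form_nonpos_eventually)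
  qed simp
  then obtain k where k: "\<forall>\<alpha>\<in>{..2 * n - 2}. perturbed_form_nonpos n k \<alpha> (2 * n - 2 - \<alpha>)"
    by (rule eventually_happens'[OF sequentially_bot, THEN exE])
  have "perturbed_form_nonpos n k \<alpha> \<beta>" if "\<alpha> + \<beta> + 2 = 2 * n" for \<alpha> \<beta>
  proof -
    have \<beta>: "\<beta> = 2 * n - 2 - \<alpha>" and \<alpha>: "\<alpha> \<in> {..2 * n - 2}" using that by auto
    show ?thesis unfolding \<beta> by (rule bspec[OF k \<alpha>])
  qed
  then show ?thesis by (auto simp: perturbed_forms_nonpos_def)
qed


section \<open>The polynomial and its support\<close>

lemma square_sum_le_card_sum_squares:
  fixes f :: "'a \<Rightarrow> real"
  shows "(\<Sum>i\<in>A. f i)\<^sup>2 \<le> real (card A) * (\<Sum>i\<in>A. (f i)\<^sup>2)"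
proof (cases "card A = 0")
  case False
  define s where "s = (\<Sum>i\<in>A. f i)"
  have "0 \<le> (\<Sum>i\<in>A. (s - real (card A) * f i)\<^sup>2)" by (rule sum_nonneg) simp
  also have "\<dots> = (\<Sum>i\<in>A. s\<^sup>2 - 2 * s * real (card A) * f i + (real (card A))\<^sup>2 * (f i)\<^sup>2)"
    by (intro sum.cong refl) (simp add: power2_diff power_mult_distrib mult_ac)
  also have "\<dots> = real (card A) * s\<^sup>2 - 2 * s * real (card A) * s + (real (card A))\<^sup>2 * (\<Sum>i\<in>A. (f i)\<^sup>2)"
    unfolding sum.distrib sum_subtractf sum_distrib_left[symmetric] s_def[symmetric] by simp
  also have "\<dots> = real (card A) * (real (card A) * (\<Sum>i\<in>A. (f i)\<^sup>2) - s\<^sup>2)"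
    by (simp add: power2_eq_square algebra_simps)
  finally show ?thesis using False by (simp add: s_def zero_le_mult_iff)
qed (auto simp: card_eq_0_iff)

definition L_vars :: "nat \<Rightarrow> L_colour hvar set" where
  "L_vars n = insert Homog (insert (Orig Bound) ((\<lambda>i. Orig (Free i)) ` {1..n}))"

lemma L_vars_eq:
  "insert Homog (Orig ` insert (bound_colour (L_graph n)) (colour (L_graph n) ` verts (L_graph n))) = L_vars n"
proof -
  have "L_col ` verts (L_graph n) = insert Bound (Free ` {1..n})"
    by (simp add: L_graph_def image_Un image_image) auto
  then show ?thesis by (simp add: L_vars_def L_graph_def image_image)
qed

lemma finite_L_vars [simp]: "finite (L_vars n)" by (simp add: L_vars_def)

lemma sum_L_vars:
  "sum f (L_vars n) = f (Orig Bound) + f Homog + (\<Sum>i\<in>{1..n}. f (Orig (Free i)))"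
  unfolding L_vars_def by (subst sum.insert; (subst sum.insert)?)
    (auto simp: sum.reindex inj_on_def add_ac)

text \<open>The support of the polynomial. The homogenised independence polynomial has degree \<open>2 n\<close>, except for \<open>n = 0\<close>,
where it is \<open>x + y\<close>; hence the maximum.\<close>

definition L_exponents :: "nat \<Rightarrow> nat \<Rightarrow> (L_colour hvar \<Rightarrow>\<^sub>0 nat) set" where
  "L_exponents n k = {m. k \<le> Poly_Mapping.lookup m (Orig Bound) \<and> k \<le> Poly_Mapping.lookup m Homog \<and>
     monom_degree m = max 1 (2 * n) + 2 * k \<and>
     (\<forall>i. Poly_Mapping.lookup m (Orig (Free i)) \<le> of_bool (i \<in> {1..n}))}"

definition L_poly :: "nat \<Rightarrow> nat \<Rightarrow> L_colour hvar mpoly" where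
  "L_poly n k = (var (Orig Bound) * var Homog) ^ k * homogenise (coloured_independence_poly (L_graph n))"

lemma L_coeff_pos:
  assumes "t \<le> n" "e + t \<le> max 1 (2 * n)"
  shows "L_coeff n t e > 0"
proof (cases "n = 0")
  case True
  with assms have "t = 0" "e = 0 \<or> e = 1" by auto
  then show ?thesis using True by (auto simp: L_coeff_def)
next
  case False
  with assms have "e \<le> 2 * n - t" by auto
  then show ?thesis by (simp add: L_coeff_def)
qed

lemma L_coeff_bound:
  assumes "t \<le> n" "L_coeff n t e > 0"
  shows "e + t \<le> max 1 (2 * n)"
proof (rule ccontr)
  assume "\<not> e + t \<le> max 1 (2 * n)"
  with assms(1) have "2 * n - t < e" "t = 0 \<Longrightarrow> n < e - 1" by auto
  then have "2 * n - t choose e = 0" "t = 0 \<Longrightarrow> n choose (e - 1) = 0"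
    by (simp_all add: binomial_eq_0)
  with assms(2) show False by (auto simp: L_coeff_def split: if_splits)
qed

lemma sum_le_n:
  assumes "\<forall>i. f i \<le> of_bool (i \<in> {1..n})"
  shows "(\<Sum>i\<in>{1..n}. f i) \<le> (n::nat)"
proof -
  have "(\<Sum>i\<in>{1..n}. f i) \<le> (\<Sum>i\<in>{1..n}. 1)"
    using assms by (intro sum_mono) (metis of_bool_eq(2))
  then show ?thesis by simp
qed

lemma monom_degree_L_colour:
  assumes "\<forall>i. Poly_Mapping.lookup m (Free i) \<le> of_bool (i \<in> {1..n})"
  shows "monom_degree m = Poly_Mapping.lookup m Bound + (\<Sum>i\<in>{1..n}. Poly_Mapping.lookup m (Free i))"
proof -
  have "Poly_Mapping.keys m \<subseteq> insert Bound (Free ` {1..n})"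
  proof
    fix c assume c: "c \<in> Poly_Mapping.keys m"
    show "c \<in> insert Bound (Free ` {1..n})"
    proof (cases c)
      case (Free i)
      with c assms[rule_format, of i] show ?thesis
        by (cases "i \<in> {1..n}") (auto simp: in_keys_iff)
    qed simp
  qed
  then have "monom_degree m = (\<Sum>c\<in>insert Bound (Free ` {1..n}). Poly_Mapping.lookup m c)"
    by (intro monom_degree_superset) auto
  then show ?thesis
    by (subst (asm) sum.insert) (auto simp: sum.reindex inj_on_def)
qed

lemma homogeneous_homogenise_L:
  "homogeneous (max 1 (2 * n)) (homogenise (coloured_independence_poly (L_graph n)))"
proof (rule homogeneous_homogenise)
  fix m assume "m \<in> Poly_Mapping.keys (coloured_independence_poly (L_graph n))"
  then have *: "Poly_Mapping.lookup (coloured_independence_poly (L_graph n)) m \<noteq> 0"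
    by (simp add: in_keys_iff)
  then have free: "\<forall>i. Poly_Mapping.lookup m (Free i) \<le> of_bool (i \<in> {1..n})"
    unfolding lookup_coloured_independence_poly_L_graph by (rule contrapos_np) (rule if_not_P)
  from * have "real (L_coeff n (\<Sum>i\<in>{1..n}. Poly_Mapping.lookup m (Free i)) (Poly_Mapping.lookup m Bound)) \<noteq> 0"
    unfolding lookup_coloured_independence_poly_L_graph if_P[OF free] .
  then have pos: "L_coeff n (\<Sum>i\<in>{1..n}. Poly_Mapping.lookup m (Free i)) (Poly_Mapping.lookup m Bound) > 0"
    by (simp only: of_nat_eq_0_iff neq0_conv)
  show "monom_degree m \<le> max 1 (2 * n)"
    unfolding monom_degree_L_colour[OF free] by (rule L_coeff_bound[OF sum_le_n[OF free] pos])
next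
  let ?m = "Poly_Mapping.single Bound (max 1 (2 * n))"
  have pos: "L_coeff n 0 (max 1 (2 * n)) > 0" by (rule L_coeff_pos) auto
  have look: "Poly_Mapping.lookup ?m (Free i) = 0" "Poly_Mapping.lookup ?m Bound = max 1 (2 * n)" for i
    by (simp_all only: lookup_single_eq) (simp add: lookup_single)
  have "Poly_Mapping.lookup (coloured_independence_poly (L_graph n)) ?m = real (L_coeff n 0 (max 1 (2 * n)))"
    unfolding lookup_coloured_independence_poly_L_graph look by (simp only: le0 sum.neutral_const simp_thms if_True)
  then show "?m \<in> Poly_Mapping.keys (coloured_independence_poly (L_graph n))"
    using pos by (simp only: in_keys_iff of_nat_eq_0_iff neq0_conv simp_thms)
  show "monom_degree ?m = max 1 (2 * n)" by simp
qed

lemma lookup_L_poly: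
  "Poly_Mapping.lookup (L_poly n k) m = (if m \<in> L_exponents n k
    then real (L_coeff n (\<Sum>i\<in>{1..n}. Poly_Mapping.lookup m (Orig (Free i))) (Poly_Mapping.lookup m (Orig Bound) - k))
    else 0)"
proof -
  define a :: "L_colour hvar \<Rightarrow>\<^sub>0 nat"
    where "a = Poly_Mapping.single (Orig Bound) k + Poly_Mapping.single Homog k"
  have a: "Poly_Mapping.lookup a (Orig Bound) = k" "Poly_Mapping.lookup a Homog = k"
    "Poly_Mapping.lookup a (Orig (Free i)) = 0" for i
    by (simp_all add: a_def lookup_add lookup_single when_def)
  have "(var (Orig Bound) * var Homog) ^ k = (Poly_Mapping.single a 1 :: L_colour hvar mpoly)"
    by (simp add: power_mult_distrib var_power mult_single a_def)
  then have P: "L_poly n k = Poly_Mapping.single a 1 * homogenise (coloured_independence_poly (L_graph n))"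
    by (simp add: L_poly_def)
  have le: "(\<forall>v. Poly_Mapping.lookup a v \<le> Poly_Mapping.lookup m v) \<longleftrightarrow>
      k \<le> Poly_Mapping.lookup m (Orig Bound) \<and> k \<le> Poly_Mapping.lookup m Homog"
  proof
    assume "\<forall>v. Poly_Mapping.lookup a v \<le> Poly_Mapping.lookup m v"
    from this[rule_format, of "Orig Bound"] this[rule_format, of Homog]
    show "k \<le> Poly_Mapping.lookup m (Orig Bound) \<and> k \<le> Poly_Mapping.lookup m Homog"
      by (simp add: a)
  next
    assume *: "k \<le> Poly_Mapping.lookup m (Orig Bound) \<and> k \<le> Poly_Mapping.lookup m Homog"
    show "\<forall>v. Poly_Mapping.lookup a v \<le> Poly_Mapping.lookup m v"
    proof
      fix v show "Poly_Mapping.lookup a v \<le> Poly_Mapping.lookup m v"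
      proof (cases v)
        case (Orig c)
        then show ?thesis using * by (cases c) (simp_all add: a)
      qed (use * in \<open>simp add: a\<close>)
    qed
  qed
  show ?thesis
  proof (cases "k \<le> Poly_Mapping.lookup m (Orig Bound) \<and> k \<le> Poly_Mapping.lookup m Homog")
    case True
    then have "m = a + (m - a)"
      using le by (intro poly_mapping_eqI) (simp add: lookup_add lookup_minus)
    then have "monom_degree m = monom_degree a + monom_degree (m - a)"
      by (metis monom_degree_add)
    moreover have "monom_degree a = 2 * k" by (simp add: a_def monom_degree_add)
    ultimately have deg: "monom_degree (m - a) = max 1 (2 * n) \<longleftrightarrow> monom_degree m = max 1 (2 * n) + 2 * k"
      by linarith
    show ?thesis
      unfolding P lookup_single_times lookup_homogenise[OF homogeneous_homogenise_L] le deg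
        lookup_coloured_independence_poly_L_graph
      using True by (simp add: L_exponents_def lookup_minus a)
  next
    case False
    then show ?thesis
      unfolding P lookup_single_times le by (auto simp: L_exponents_def)
  qed
qed

lemma keys_subset_L_vars:
  assumes "m \<in> L_exponents n k"
  shows "Poly_Mapping.keys m \<subseteq> L_vars n"
proof
  fix v assume v: "v \<in> Poly_Mapping.keys m"
  show "v \<in> L_vars n"
  proof (cases v)
    case (Orig c)
    show ?thesis
    proof (cases c)
      case (Free i)
      have "Poly_Mapping.lookup m (Orig (Free i)) \<le> of_bool (i \<in> {1..n})"
        using assms by (auto simp: L_exponents_def)
      then have "i \<in> {1..n}" using v Orig Free by (cases "i \<in> {1..n}") (auto simp: in_keys_iff)
      then show ?thesis using Orig Free by (simp add: L_vars_def)
    qed (simp add: Orig L_vars_def)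
  qed (simp add: L_vars_def)
qed

lemma monom_degree_L_vars:
  assumes "Poly_Mapping.keys m \<subseteq> L_vars n"
  shows "monom_degree m = Poly_Mapping.lookup m (Orig Bound) + Poly_Mapping.lookup m Homog
    + (\<Sum>i\<in>{1..n}. Poly_Mapping.lookup m (Orig (Free i)))"
  using assms by (simp add: monom_degree_superset[of "L_vars n"] sum_L_vars)

lemma keys_L_poly: "Poly_Mapping.keys (L_poly n k) = L_exponents n k"
proof -
  have "L_coeff n (\<Sum>i\<in>{1..n}. Poly_Mapping.lookup m (Orig (Free i))) (Poly_Mapping.lookup m (Orig Bound) - k) > 0"
    if m: "m \<in> L_exponents n k" for m
  proof (rule L_coeff_pos)
    show "(\<Sum>i\<in>{1..n}. Poly_Mapping.lookup m (Orig (Free i))) \<le> n"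
      using m by (intro sum_le_n) (simp add: L_exponents_def)
    show "Poly_Mapping.lookup m (Orig Bound) - k + (\<Sum>i\<in>{1..n}. Poly_Mapping.lookup m (Orig (Free i)))
        \<le> max 1 (2 * n)"
      using m monom_degree_L_vars[OF keys_subset_L_vars[OF m]] by (simp add: L_exponents_def) linarith
  qed
  then show ?thesis by (intro Set.set_eqI) (simp add: in_keys_iff lookup_L_poly)
qed

lemma M_convex_support_L_poly: "M_convex (L_vars n) (support (L_poly n k))"
proof (rule M_convex_box_slice)
  let ?lo = "\<lambda>v. case v of Orig (Free i) \<Rightarrow> 0 | _ \<Rightarrow> int k"
  let ?hi = "\<lambda>v. case v of Orig (Free i) \<Rightarrow> 1 | _ \<Rightarrow> int (max 1 (2 * n) + 2 * k)"
  let ?D = "int (max 1 (2 * n) + 2 * k)"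
  let ?B = "{\<alpha>. (\<forall>v\<in>L_vars n. ?lo v \<le> \<alpha> v \<and> \<alpha> v \<le> ?hi v) \<and> (\<forall>v. v \<notin> L_vars n \<longrightarrow> \<alpha> v = 0) \<and>
      sum \<alpha> (L_vars n) = ?D}"
  show "support (L_poly n k) = ?B"
  proof (intro Set.set_eqI iffI)
    fix \<alpha> assume "\<alpha> \<in> support (L_poly n k)"
    then obtain m where m: "m \<in> L_exponents n k" and \<alpha>: "\<alpha> = (\<lambda>v. int (Poly_Mapping.lookup m v))"
      by (auto simp: support_def keys_L_poly)
    note keys = keys_subset_L_vars[OF m]
    have deg: "monom_degree m = max 1 (2 * n) + 2 * k" using m by (simp add: L_exponents_def)
    have sum: "sum \<alpha> (L_vars n) = ?D"
      unfolding \<alpha> of_nat_sum[symmetric] using monom_degree_superset[OF finite_L_vars keys] deg by simp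
    have le: "Poly_Mapping.lookup m v \<le> max 1 (2 * n) + 2 * k" if "v \<in> L_vars n" for v
      using member_le_sum[OF that, of "Poly_Mapping.lookup m"] monom_degree_superset[OF finite_L_vars keys] deg
      by simp
    have "?lo v \<le> \<alpha> v \<and> \<alpha> v \<le> ?hi v" if v: "v \<in> L_vars n" for v
    proof (cases v)
      case (Orig c)
      show ?thesis
      proof (cases c)
        case (Free i)
        have "Poly_Mapping.lookup m (Orig (Free i)) \<le> of_bool (i \<in> {1..n})"
          using m by (auto simp: L_exponents_def)
        also have "\<dots> \<le> 1" by simp
        finally show ?thesis by (simp add: Orig Free \<alpha>)
      qed (use m le[OF v] in \<open>simp add: Orig \<alpha> L_exponents_def\<close>)
    qed (use m le[OF v] in \<open>simp add: \<alpha> L_exponents_def\<close>)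
    moreover have "\<alpha> v = 0" if "v \<notin> L_vars n" for v
      using keys that by (auto simp: \<alpha> in_keys_iff)
    ultimately show "\<alpha> \<in> ?B" using sum by blast
  next
    fix \<alpha> assume "\<alpha> \<in> ?B"
    then have box: "\<And>v. v \<in> L_vars n \<Longrightarrow> ?lo v \<le> \<alpha> v \<and> \<alpha> v \<le> ?hi v"
      and out: "\<And>v. v \<notin> L_vars n \<Longrightarrow> \<alpha> v = 0" and sum: "sum \<alpha> (L_vars n) = ?D" by auto
    have nonneg: "\<alpha> v \<ge> 0" for v
    proof (cases "v \<in> L_vars n")
      case True
      have "0 \<le> ?lo v" by (simp split: hvar.split L_colour.split)
      with box[OF True] show ?thesis by linarith
    qed (simp add: out)
    define m where "m = Abs_poly_mapping (\<lambda>v. nat (\<alpha> v))"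
    have "finite {v. nat (\<alpha> v) \<noteq> 0}"
    proof (rule finite_subset)
      show "{v. nat (\<alpha> v) \<noteq> 0} \<subseteq> L_vars n"
      proof
        fix v assume "v \<in> {v. nat (\<alpha> v) \<noteq> 0}"
        then show "v \<in> L_vars n" using out[of v] by fastforce
      qed
    qed simp
    then have m: "Poly_Mapping.lookup m v = nat (\<alpha> v)" for v by (simp add: m_def)
    have keys: "Poly_Mapping.keys m \<subseteq> L_vars n"
    proof
      fix v assume "v \<in> Poly_Mapping.keys m"
      then show "v \<in> L_vars n" using out[of v] by (fastforce simp: in_keys_iff m)
    qed
    have \<alpha>: "\<alpha> = (\<lambda>v. int (Poly_Mapping.lookup m v))" using nonneg by (simp add: m)
    have "int (monom_degree m) = sum \<alpha> (L_vars n)"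
      unfolding \<alpha> by (simp add: monom_degree_superset[OF finite_L_vars keys])
    with sum have "monom_degree m = max 1 (2 * n) + 2 * k" by linarith
    moreover have "k \<le> Poly_Mapping.lookup m (Orig Bound)"
      using box[of "Orig Bound"] by (simp add: m L_vars_def) linarith
    moreover have "k \<le> Poly_Mapping.lookup m Homog"
      using box[of Homog] by (simp add: m L_vars_def) linarith
    moreover have "Poly_Mapping.lookup m (Orig (Free i)) \<le> of_bool (i \<in> {1..n})" for i
    proof (cases "i \<in> {1..n}")
      case True
      then have "Orig (Free i) \<in> L_vars n" by (simp add: L_vars_def)
      from box[OF this] True show ?thesis by (simp add: m nat_le_iff)
    next
      case False
      then have "Orig (Free i) \<notin> L_vars n" by (auto simp: L_vars_def)
      then show ?thesis by (simp add: m out)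
    qed
    ultimately have "m \<in> L_exponents n k" by (simp add: L_exponents_def)
    then show "\<alpha> \<in> support (L_poly n k)" by (auto simp: support_def keys_L_poly \<alpha>)
  qed
qed (simp_all add: support_def)

lemma normalised_coeff_L_poly:
  "normalised_coeff (L_poly n k) m = (if m \<in> L_exponents n k
    then fact (Poly_Mapping.lookup m (Orig Bound)) * fact (Poly_Mapping.lookup m Homog) *
      real (L_coeff n (\<Sum>i\<in>{1..n}. Poly_Mapping.lookup m (Orig (Free i))) (Poly_Mapping.lookup m (Orig Bound) - k))
    else 0)"
proof (cases "m \<in> L_exponents n k")
  case True
  have "exponent_fact m = (\<Prod>v\<in>L_vars n. fact (Poly_Mapping.lookup m v))"
    by (rule exponent_fact_superset) (simp_all add: keys_subset_L_vars[OF True])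
  also have "\<dots> = fact (Poly_Mapping.lookup m Homog) * (fact (Poly_Mapping.lookup m (Orig Bound)) *
      (\<Prod>i\<in>{1..n}. fact (Poly_Mapping.lookup m (Orig (Free i)))))"
    unfolding L_vars_def by (subst prod.insert; (subst prod.insert)?) (auto simp: prod.reindex inj_on_def)
  also have "(\<Prod>i\<in>{1..n}. fact (Poly_Mapping.lookup m (Orig (Free i)))) = (1::real)"
  proof (rule prod.neutral, rule ballI)
    fix i assume "i \<in> {1..n}"
    have "Poly_Mapping.lookup m (Orig (Free i)) \<le> of_bool (i \<in> {1..n})"
      using True by (auto simp: L_exponents_def)
    also have "\<dots> \<le> 1" by simp
    finally show "fact (Poly_Mapping.lookup m (Orig (Free i))) = (1::real)"
      by (cases "Poly_Mapping.lookup m (Orig (Free i))") auto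
  qed
  finally show ?thesis using True by (simp add: normalised_coeff_def lookup_L_poly)
qed (simp add: normalised_coeff_def lookup_L_poly)


section \<open>The Hessians of the polynomial\<close>

lemma hessian_form_L_vars:
  fixes p :: "L_colour hvar mpoly" and \<mu> \<xi>
  defines "q \<equiv> \<lambda>v w. normalised_coeff p (\<mu> + Poly_Mapping.single v 1 + Poly_Mapping.single w 1)"
  shows "hessian_form (L_vars n) p \<mu> \<xi> =
    q (Orig Bound) (Orig Bound) * (\<xi> (Orig Bound))\<^sup>2 + 2 * q (Orig Bound) Homog * (\<xi> (Orig Bound) * \<xi> Homog)
    + q Homog Homog * (\<xi> Homog)\<^sup>2
    + 2 * (\<Sum>i\<in>{1..n}. (q (Orig Bound) (Orig (Free i)) * \<xi> (Orig Bound) + q Homog (Orig (Free i)) * \<xi> Homog) * \<xi> (Orig (Free i)))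
    + (\<Sum>i\<in>{1..n}. \<Sum>j\<in>{1..n}. q (Orig (Free i)) (Orig (Free j)) * (\<xi> (Orig (Free i)) * \<xi> (Orig (Free j))))"
proof -
  have sym: "q v w = q w v" for v w by (simp only: q_def add_ac)
  have "hessian_form (L_vars n) p \<mu> \<xi> = (\<Sum>v\<in>L_vars n. \<Sum>w\<in>L_vars n. \<xi> v * \<xi> w * q v w)"
    by (simp only: hessian_form_def q_def)
  also have "\<dots> = \<xi> (Orig Bound) * \<xi> (Orig Bound) * q (Orig Bound) (Orig Bound)
      + \<xi> (Orig Bound) * \<xi> Homog * q (Orig Bound) Homog
      + (\<Sum>i\<in>{1..n}. \<xi> (Orig Bound) * \<xi> (Orig (Free i)) * q (Orig Bound) (Orig (Free i)))
      + (\<xi> Homog * \<xi> (Orig Bound) * q (Orig Bound) Homog + \<xi> Homog * \<xi> Homog * q Homog Homog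
      + (\<Sum>i\<in>{1..n}. \<xi> Homog * \<xi> (Orig (Free i)) * q Homog (Orig (Free i))))
      + ((\<Sum>i\<in>{1..n}. \<xi> (Orig (Free i)) * \<xi> (Orig Bound) * q (Orig Bound) (Orig (Free i)))
      + (\<Sum>i\<in>{1..n}. \<xi> (Orig (Free i)) * \<xi> Homog * q Homog (Orig (Free i)))
      + (\<Sum>i\<in>{1..n}. \<Sum>j\<in>{1..n}. \<xi> (Orig (Free i)) * \<xi> (Orig (Free j)) * q (Orig (Free i)) (Orig (Free j))))"
    unfolding sum_L_vars sum.distrib sym[of Homog "Orig Bound"] sym[of "Orig (Free _)" "Orig Bound"]
      sym[of "Orig (Free _)" Homog] by (simp only: ac_simps)
  finally show ?thesis
    by (simp add: distrib_left distrib_right sum.distrib sum_distrib_left power2_eq_square mult_ac)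
qed

text \<open>The set \<open>S\<close> consists of the indices \<open>i\<close> for which \<open>z\<^sub>i\<close> has already been differentiated. The polynomial
has degree one in each \<open>z\<^sub>i\<close>, so the rows of these variables vanish, as do the diagonal entries of the
others.\<close>

lemma hessian_form_L_poly_interior:
  assumes S: "S \<subseteq> {1..n}" and n: "\<alpha> + \<beta> + 2 + card S = 2 * n"
    and \<mu>: "Poly_Mapping.lookup \<mu> (Orig Bound) = k + \<alpha>" "Poly_Mapping.lookup \<mu> Homog = k + \<beta>"
      "\<And>i. Poly_Mapping.lookup \<mu> (Orig (Free i)) = of_bool (i \<in> S)"
    and deg: "monom_degree \<mu> + 2 = 2 * n + 2 * k"
  shows "hessian_form (L_vars n) (L_poly n k) \<mu> \<xi> =
    kernel_form (k + \<alpha>) (k + \<beta>) (real (L_coeff n (card S) (\<alpha> + 2))) (real (L_coeff n (card S) (\<alpha> + 1)))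
      (real (L_coeff n (card S) \<alpha>)) (real (L_coeff n (card S + 1) (\<alpha> + 1))) (real (L_coeff n (card S + 1) \<alpha>))
      (real (L_coeff n (card S + 2) \<alpha>)) (\<xi> (Orig Bound)) (\<xi> Homog)
      (\<Sum>i\<in>{1..n} - S. \<xi> (Orig (Free i))) (\<Sum>i\<in>{1..n} - S. (\<xi> (Orig (Free i)))\<^sup>2)"
proof -
  define R where "R = {1..n} - S"
  define q where "q = (\<lambda>v w. normalised_coeff (L_poly n k) (\<mu> + Poly_Mapping.single v 1 + Poly_Mapping.single w 1))"
  have finR: "finite R" by (simp add: R_def)
  have n0: "max 1 (2 * n) = 2 * n" using n by simp
  have sumS: "(\<Sum>i\<in>{1..n}. of_bool (i \<in> S)) = card S"
    using S by (simp add: of_bool_def Int_absorb1 flip: sum.inter_restrict)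
  have sumi: "(\<Sum>l\<in>{1..n}. of_bool (l = i)) = (1::nat)" if "i \<in> {1..n}" for i
    using that by (simp add: of_bool_def)
  have single: "Poly_Mapping.lookup (Poly_Mapping.single (Orig (Free i)) 1) (Orig (Free l)) = (of_bool (l = i) :: nat)"
    "Poly_Mapping.lookup (Poly_Mapping.single (Orig Bound) 1) (Orig (Free l)) = (0 :: nat)"
    "Poly_Mapping.lookup (Poly_Mapping.single Homog 1) (Orig (Free l)) = (0 :: nat)"
    "Poly_Mapping.lookup (Poly_Mapping.single (Orig (Free i)) 1) (Orig Bound) = (0 :: nat)"
    "Poly_Mapping.lookup (Poly_Mapping.single (Orig (Free i)) 1) Homog = (0 :: nat)"
    "Poly_Mapping.lookup (Poly_Mapping.single Homog 1) (Orig Bound) = (0 :: nat)"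
    "Poly_Mapping.lookup (Poly_Mapping.single (Orig Bound) 1) Homog = (0 :: nat)" for i l
    by (simp_all add: lookup_single when_def)
  have SR: "i \<in> S \<Longrightarrow> i \<in> {1..n}" "i \<in> S \<Longrightarrow> i \<notin> R" "i \<in> R \<Longrightarrow> i \<in> {1..n}" "i \<in> R \<Longrightarrow> i \<notin> S"
    "i \<in> {1..n} \<Longrightarrow> i \<notin> R \<Longrightarrow> i \<in> S" for i
    using S by (auto simp: R_def)
  have ind0: "\<forall>l. of_bool (l \<in> S) \<le> (of_bool (l \<in> {1..n}) :: nat)"
    using SR(1) by (simp add: of_bool_def)
  have ind1: "(\<forall>l. of_bool (l \<in> S) + of_bool (l = i) \<le> (of_bool (l \<in> {1..n}) :: nat)) \<longleftrightarrow> i \<in> R"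
    if "i \<in> {1..n}" for i
  proof
    assume "\<forall>l. of_bool (l \<in> S) + of_bool (l = i) \<le> (of_bool (l \<in> {1..n}) :: nat)"
    from this[rule_format, of i] show "i \<in> R" using SR(5)[OF that] that by (cases "i \<in> S") auto
  next
    assume "i \<in> R"
    then have "of_bool (l \<in> S) + of_bool (l = i) \<le> (of_bool (l \<in> {1..n}) :: nat)" for l
      using ind0[rule_format, of l] SR(4) that by (cases "l = i") simp_all
    then show "\<forall>l. of_bool (l \<in> S) + of_bool (l = i) \<le> (of_bool (l \<in> {1..n}) :: nat)" ..
  qed
  have ind2: "(\<forall>l. of_bool (l \<in> S) + of_bool (l = i) + of_bool (l = j) \<le> (of_bool (l \<in> {1..n}) :: nat))
      \<longleftrightarrow> i \<in> R \<and> j \<in> R \<and> i \<noteq> j"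
    if ij: "i \<in> {1..n}" "j \<in> {1..n}" for i j
  proof
    assume *: "\<forall>l. of_bool (l \<in> S) + of_bool (l = i) + of_bool (l = j) \<le> (of_bool (l \<in> {1..n}) :: nat)"
    from *[rule_format, of i] *[rule_format, of j] show "i \<in> R \<and> j \<in> R \<and> i \<noteq> j"
      using SR(5)[OF ij(1)] SR(5)[OF ij(2)] ij by (cases "i \<in> S"; cases "j \<in> S"; cases "i = j") auto
  next
    assume "i \<in> R \<and> j \<in> R \<and> i \<noteq> j"
    then have "of_bool (l \<in> S) + of_bool (l = i) + of_bool (l = j) \<le> (of_bool (l \<in> {1..n}) :: nat)" for l
      using ind0[rule_format, of l] SR(4) ij by (cases "l = i"; cases "l = j") simp_all
    then show "\<forall>l. of_bool (l \<in> S) + of_bool (l = i) + of_bool (l = j) \<le> (of_bool (l \<in> {1..n}) :: nat)" ..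
  qed
  have q: "q v w = (if (k \<le> Poly_Mapping.lookup (\<mu> + Poly_Mapping.single v 1 + Poly_Mapping.single w 1) (Orig Bound) \<and>
      k \<le> Poly_Mapping.lookup (\<mu> + Poly_Mapping.single v 1 + Poly_Mapping.single w 1) Homog \<and>
      (\<forall>i. Poly_Mapping.lookup (\<mu> + Poly_Mapping.single v 1 + Poly_Mapping.single w 1) (Orig (Free i)) \<le> of_bool (i \<in> {1..n})))
    then fact (Poly_Mapping.lookup (\<mu> + Poly_Mapping.single v 1 + Poly_Mapping.single w 1) (Orig Bound))
      * fact (Poly_Mapping.lookup (\<mu> + Poly_Mapping.single v 1 + Poly_Mapping.single w 1) Homog) *
      real (L_coeff n (\<Sum>i\<in>{1..n}. Poly_Mapping.lookup (\<mu> + Poly_Mapping.single v 1 + Poly_Mapping.single w 1) (Orig (Free i)))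
       (Poly_Mapping.lookup (\<mu> + Poly_Mapping.single v 1 + Poly_Mapping.single w 1) (Orig Bound) - k))
    else 0)" for v w
  proof -
    have "monom_degree (\<mu> + Poly_Mapping.single v 1 + Poly_Mapping.single w 1) = 2 * n + 2 * k"
      using deg by (simp only: monom_degree_add monom_degree_single)
    then show ?thesis
      unfolding q_def normalised_coeff_L_poly L_exponents_def mem_Collect_eq n0 by (simp only: simp_thms)
  qed
  have ar: "k + \<alpha> + 1 + 1 - k = \<alpha> + 2" "k + \<alpha> + 1 - k = \<alpha> + 1" "k + \<alpha> - k = \<alpha>" by simp_all
  have xx: "q (Orig Bound) (Orig Bound) = fact (k + \<alpha> + 2) * fact (k + \<beta>) * real (L_coeff n (card S) (\<alpha> + 2))"
    unfolding q lookup_add \<mu> single lookup_single_eq add_0_right ar sumS using ind0 by (simp add: numeral_2_eq_2)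
  have xy: "q (Orig Bound) Homog = fact (k + \<alpha> + 1) * fact (k + \<beta> + 1) * real (L_coeff n (card S) (\<alpha> + 1))"
    unfolding q lookup_add \<mu> single lookup_single_eq add_0_right ar sumS using ind0 by simp
  have yy: "q Homog Homog = fact (k + \<alpha>) * fact (k + \<beta> + 2) * real (L_coeff n (card S) \<alpha>)"
    unfolding q lookup_add \<mu> single lookup_single_eq add_0_right ar sumS using ind0 by (simp add: numeral_2_eq_2)
  have xz: "q (Orig Bound) (Orig (Free i)) =
      (if i \<in> R then fact (k + \<alpha> + 1) * fact (k + \<beta>) * real (L_coeff n (card S + 1) (\<alpha> + 1)) else 0)"
    if "i \<in> {1..n}" for i
    unfolding q lookup_add \<mu> single lookup_single_eq add_0_right ar sum.distrib sumS sumi[OF that] ind1[OF that] by simp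
  have yz: "q Homog (Orig (Free i)) =
      (if i \<in> R then fact (k + \<alpha>) * fact (k + \<beta> + 1) * real (L_coeff n (card S + 1) \<alpha>) else 0)"
    if "i \<in> {1..n}" for i
    unfolding q lookup_add \<mu> single lookup_single_eq add_0_right ar sum.distrib sumS sumi[OF that] ind1[OF that] by simp
  have zz: "q (Orig (Free i)) (Orig (Free j)) =
      (if i \<in> R \<and> j \<in> R \<and> i \<noteq> j then fact (k + \<alpha>) * fact (k + \<beta>) * real (L_coeff n (card S + 2) \<alpha>) else 0)"
    if "i \<in> {1..n}" "j \<in> {1..n}" for i j
    unfolding q lookup_add \<mu> single lookup_single_eq add_0_right ar sum.distrib sumS sumi[OF that(1)] sumi[OF that(2)] ind2[OF that]
    by (simp add: numeral_2_eq_2)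
  define z where "z = (\<lambda>i. \<xi> (Orig (Free i)))"
  have restrict: "(\<Sum>i\<in>{1..n}. if i \<in> R then f i else 0) = sum f R" for f :: "nat \<Rightarrow> real"
  proof -
    have "{1..n} \<inter> R = R" by (auto simp: R_def)
    then show ?thesis by (simp flip: sum.inter_restrict)
  qed
  have lin: "(\<Sum>i\<in>{1..n}. (q (Orig Bound) (Orig (Free i)) * \<xi> (Orig Bound) + q Homog (Orig (Free i)) * \<xi> Homog) * z i) =
      (fact (k + \<alpha> + 1) * fact (k + \<beta>) * real (L_coeff n (card S + 1) (\<alpha> + 1)) * \<xi> (Orig Bound)
       + fact (k + \<alpha>) * fact (k + \<beta> + 1) * real (L_coeff n (card S + 1) \<alpha>) * \<xi> Homog) * sum z R"
    (is "_ = ?c * _")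
  proof -
    have "(\<Sum>i\<in>{1..n}. (q (Orig Bound) (Orig (Free i)) * \<xi> (Orig Bound) + q Homog (Orig (Free i)) * \<xi> Homog) * z i) =
        (\<Sum>i\<in>{1..n}. if i \<in> R then ?c * z i else 0)"
      by (intro sum.cong refl) (simp add: xz yz)
    then show ?thesis by (simp only: restrict sum_distrib_left)
  qed
  have quad: "(\<Sum>i\<in>{1..n}. \<Sum>j\<in>{1..n}. q (Orig (Free i)) (Orig (Free j)) * (z i * z j)) =
      fact (k + \<alpha>) * fact (k + \<beta>) * real (L_coeff n (card S + 2) \<alpha>) * ((sum z R)\<^sup>2 - (\<Sum>i\<in>R. (z i)\<^sup>2))"
    (is "_ = ?d * _")
  proof -
    have "(\<Sum>i\<in>{1..n}. \<Sum>j\<in>{1..n}. q (Orig (Free i)) (Orig (Free j)) * (z i * z j)) =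
        (\<Sum>i\<in>{1..n}. if i \<in> R then (\<Sum>j\<in>{1..n}. if j \<in> R then (if i \<noteq> j then ?d * (z i * z j) else 0) else 0) else 0)"
    proof (rule sum.cong[OF refl])
      fix i assume i: "i \<in> {1..n}"
      show "(\<Sum>j\<in>{1..n}. q (Orig (Free i)) (Orig (Free j)) * (z i * z j)) =
        (if i \<in> R then (\<Sum>j\<in>{1..n}. if j \<in> R then (if i \<noteq> j then ?d * (z i * z j) else 0) else 0) else 0)"
      proof (cases "i \<in> R")
        case True
        have "(\<Sum>j\<in>{1..n}. q (Orig (Free i)) (Orig (Free j)) * (z i * z j)) =
          (\<Sum>j\<in>{1..n}. if j \<in> R then (if i \<noteq> j then ?d * (z i * z j) else 0) else 0)"
          by (intro sum.cong refl) (simp add: zz[OF i] True)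
        with True show ?thesis by (simp only: if_True)
      next
        case False
        have "(\<Sum>j\<in>{1..n}. q (Orig (Free i)) (Orig (Free j)) * (z i * z j)) = 0"
          by (intro sum.neutral ballI) (simp add: zz[OF i] False)
        with False show ?thesis by (simp only: if_False)
      qed
    qed
    also have "\<dots> = (\<Sum>i\<in>R. \<Sum>j\<in>R. if i \<noteq> j then ?d * (z i * z j) else 0)"
      by (simp only: restrict)
    also have "\<dots> = (\<Sum>i\<in>R. \<Sum>j\<in>R. ?d * (z i * z j) - (if i = j then ?d * (z j)\<^sup>2 else 0))"
      by (intro sum.cong refl) (simp add: power2_eq_square)
    also have "\<dots> = (\<Sum>i\<in>R. \<Sum>j\<in>R. ?d * (z i * z j)) - (\<Sum>i\<in>R. ?d * (z i)\<^sup>2)"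
      using finR by (simp add: sum_subtractf)
    also have "(\<Sum>i\<in>R. \<Sum>j\<in>R. ?d * (z i * z j)) = ?d * (sum z R)\<^sup>2"
      unfolding power2_eq_square sum_product by (simp only: sum_distrib_left)
    also have "(\<Sum>i\<in>R. ?d * (z i)\<^sup>2) = ?d * (\<Sum>i\<in>R. (z i)\<^sup>2)"
      by (rule sum_distrib_left[symmetric])
    finally show ?thesis by (simp only: right_diff_distrib)
  qed
  have fold_q: "normalised_coeff (L_poly n k) (\<mu> + Poly_Mapping.single v 1 + Poly_Mapping.single w 1) = q v w" for v w
    by (simp only: q_def)
  show ?thesis
    unfolding hessian_form_L_vars fold_q kernel_form_def ternary_form_def R_def[symmetric]
      lin[unfolded z_def] quad[unfolded z_def] xx xy yy
    by (simp only: mult_ac)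
qed

text \<open>By the Cauchy-Schwarz inequality the square of the sum of the \<open>n - card S\<close> variables \<open>z\<^sub>i\<close> is at most
\<open>n - card S\<close> times the sum of their squares. For nonempty \<open>S\<close> this is used only in the weaker form with the
factor \<open>2 n - card S\<close>; for empty \<open>S\<close> the factor \<open>n\<close> is essential.\<close>

lemma hessian_form_L_poly_nonpos_interior:
  assumes n: "n > 0"
    and good: "perturbed_forms_nonpos n k"
    and S: "S \<subseteq> {1..n}" and N: "\<alpha> + \<beta> + 2 + card S = 2 * n"
    and \<mu>: "Poly_Mapping.lookup \<mu> (Orig Bound) = k + \<alpha>" "Poly_Mapping.lookup \<mu> Homog = k + \<beta>"
      "\<And>i. Poly_Mapping.lookup \<mu> (Orig (Free i)) = of_bool (i \<in> S)"
    and deg: "monom_degree \<mu> + 2 = 2 * n + 2 * k"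
    and hyp: "real (\<alpha> + \<beta> + 2) * (real (k + \<alpha> + 1) * \<xi> (Orig Bound) / real (Suc \<alpha>)
      + real (k + \<beta> + 1) * \<xi> Homog / real (Suc \<beta>)) + (\<Sum>i\<in>{1..n} - S. \<xi> (Orig (Free i))) = 0"
  shows "hessian_form (L_vars n) (L_poly n k) \<mu> \<xi> \<le> 0"
proof -
  let ?s = "\<Sum>i\<in>{1..n} - S. \<xi> (Orig (Free i))" and ?Q = "\<Sum>i\<in>{1..n} - S. (\<xi> (Orig (Free i)))\<^sup>2"
  have finS: "finite S" using S finite_subset by blast
  have cardR: "card ({1..n} - S) = n - card S" using S by (simp add: card_Diff_subset finS)
  have CS: "?s\<^sup>2 \<le> real (n - card S) * ?Q"
    using square_sum_le_card_sum_squares[of "\<lambda>i. \<xi> (Orig (Free i))" "{1..n} - S"] by (simp only: cardR)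
  have Q0: "?Q \<ge> 0" by (rule sum_nonneg) simp
  have eq: "2 * n - card S = Suc (Suc (\<alpha> + \<beta>))" "2 * n - (card S + 1) = Suc (\<alpha> + \<beta>)"
    "2 * n - (card S + 2) = \<alpha> + \<beta>"
    using N by linarith+
  have coeff: "L_coeff n (card S + 1) (\<alpha> + 1) = (Suc (\<alpha> + \<beta>) choose Suc \<alpha>)"
    "L_coeff n (card S + 1) \<alpha> = (Suc (\<alpha> + \<beta>) choose \<alpha>)" "L_coeff n (card S + 2) \<alpha> = (\<alpha> + \<beta> choose \<alpha>)"
    by (simp_all only: L_coeff_def eq) simp_all
  note form = hessian_form_L_poly_interior[OF S N \<mu> deg, of \<xi>]
  show ?thesis
  proof (cases "S = {}")
    case True
    have coeff0: "L_coeff n (card S) (\<alpha> + 2) = (Suc (Suc (\<alpha> + \<beta>)) choose Suc (Suc \<alpha>)) + (n choose Suc \<alpha>)"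
      "L_coeff n (card S) (\<alpha> + 1) = (Suc (Suc (\<alpha> + \<beta>)) choose Suc \<alpha>) + (n choose \<alpha>)"
      "L_coeff n (card S) \<alpha> = (Suc (Suc (\<alpha> + \<beta>)) choose \<alpha>) + (if \<alpha> = 0 then 0 else n choose (\<alpha> - 1))"
      unfolding L_coeff_def eq using True by simp_all
    have "?Q \<ge> ?s\<^sup>2 / real n" using CS n True by (simp add: divide_le_eq mult.commute)
    moreover have "real (\<alpha> + \<beta> + 2) = real (2 * n)" using N True by simp
    moreover have "\<alpha> + \<beta> + 2 = 2 * n" using N True by simp
    ultimately show ?thesis
      unfolding form coeff coeff0 of_nat_add[of "_ choose _"] using hyp by (intro perturbed_forms_nonposD[OF good]) simp_all
  next
    case False
    then have "card S > 0" using finS by (simp add: card_gt_0_iff)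
    then have coeff1: "L_coeff n (card S) e = (Suc (Suc (\<alpha> + \<beta>)) choose e)" for e
      unfolding L_coeff_def eq by simp
    have "real (n - card S) * ?Q \<le> real (\<alpha> + \<beta> + 2) * ?Q"
      using N card_mono[OF _ S] Q0 by (intro mult_right_mono) auto
    with CS have "?s\<^sup>2 \<le> real (\<alpha> + \<beta> + 2) * ?Q" by linarith
    moreover have pos: "0 < real (\<alpha> + \<beta> + 2)" by simp
    ultimately have "?Q \<ge> ?s\<^sup>2 / real (\<alpha> + \<beta> + 2)"
      by (simp only: pos_divide_le_eq[OF pos] mult.commute)
    from kernel_form_unperturbed_nonpos[OF this hyp] show ?thesis
      unfolding form coeff coeff1 by simp
  qed
qed

text \<open>Outside the interior case all terms of the form share a common variable, and the hyperplane where that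
variable vanishes does; if some \<open>z\<^sub>i\<close> has been differentiated twice, the form is zero.\<close>

lemma hessian_form_L_poly_nonpos:
  assumes n: "n > 0"
    and good: "perturbed_forms_nonpos n k"
    and deg: "monom_degree \<mu> + 2 = 2 * n + 2 * k" and keys: "Poly_Mapping.keys \<mu> \<subseteq> L_vars n"
  shows "\<exists>l. \<forall>\<xi>. (\<Sum>v\<in>L_vars n. l v * \<xi> v) = 0 \<longrightarrow> hessian_form (L_vars n) (L_poly n k) \<mu> \<xi> \<le> 0"
proof -
  let ?q = "\<lambda>v w. normalised_coeff (L_poly n k) (\<mu> + Poly_Mapping.single v 1 + Poly_Mapping.single w 1)"
  \<comment> \<open>The hyperplane \<open>\<xi> u = 0\<close>, for a form all of whose terms contain the variable \<open>u\<close>.\<close>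
  have support_one: "\<exists>l. \<forall>\<xi>. (\<Sum>v\<in>L_vars n. l v * \<xi> v) = 0 \<longrightarrow> hessian_form (L_vars n) (L_poly n k) \<mu> \<xi> \<le> 0"
    if u: "u \<in> L_vars n" and zero: "\<And>v w. v \<noteq> u \<Longrightarrow> w \<noteq> u \<Longrightarrow> ?q v w = 0" for u
  proof (intro exI[of _ "\<lambda>v. of_bool (v = u)"] allI impI)
    fix \<xi> :: "L_colour hvar \<Rightarrow> real"
    assume "(\<Sum>v\<in>L_vars n. of_bool (v = u) * \<xi> v) = 0"
    then have "\<xi> u = 0" using u by (simp add: of_bool_def if_distrib[of "\<lambda>x. x * _"] cong: if_cong)
    then have "\<xi> v * \<xi> w * ?q v w = 0" for v w
      using zero[of v w] by (cases "v = u"; cases "w = u") auto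
    then show "hessian_form (L_vars n) (L_poly n k) \<mu> \<xi> \<le> 0"
      by (simp only: hessian_form_def sum.neutral_const order_refl)
  qed
  have q0: "?q v w = 0" if "\<mu> + Poly_Mapping.single v 1 + Poly_Mapping.single w 1 \<notin> L_exponents n k" for v w
    using that by (simp add: normalised_coeff_L_poly)
  consider (big) i where "\<not> Poly_Mapping.lookup \<mu> (Orig (Free i)) \<le> of_bool (i \<in> {1..n})"
    | (x) "Poly_Mapping.lookup \<mu> (Orig Bound) < k" | (y) "Poly_Mapping.lookup \<mu> Homog < k"
    | (int) "\<forall>i. Poly_Mapping.lookup \<mu> (Orig (Free i)) \<le> of_bool (i \<in> {1..n})"
      "k \<le> Poly_Mapping.lookup \<mu> (Orig Bound)" "k \<le> Poly_Mapping.lookup \<mu> Homog"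
    by (meson not_le)
  then show ?thesis
  proof cases
    case big
    show ?thesis
    proof (rule support_one[of Homog])
      fix v w
      have "\<not> Poly_Mapping.lookup (\<mu> + Poly_Mapping.single v 1 + Poly_Mapping.single w 1) (Orig (Free i)) \<le> of_bool (i \<in> {1..n})"
        using big by (simp add: lookup_add del: of_bool_eq)
      then have "\<mu> + Poly_Mapping.single v 1 + Poly_Mapping.single w 1 \<notin> L_exponents n k"
        unfolding L_exponents_def by blast
      then show "?q v w = 0" by (rule q0)
    qed (simp add: L_vars_def)
  next
    case x
    show ?thesis
    proof (rule support_one[of "Orig Bound"])
      fix v w :: "L_colour hvar" assume "v \<noteq> Orig Bound" "w \<noteq> Orig Bound"
      then show "?q v w = 0"
        using x by (intro q0) (simp add: L_exponents_def lookup_add lookup_single when_def)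
    qed (simp add: L_vars_def)
  next
    case y
    show ?thesis
    proof (rule support_one[of Homog])
      fix v w :: "L_colour hvar" assume "v \<noteq> Homog" "w \<noteq> Homog"
      then show "?q v w = 0"
        using y by (intro q0) (simp add: L_exponents_def lookup_add lookup_single when_def)
    qed (simp add: L_vars_def)
  next
    case int
    define S where "S = {i. Poly_Mapping.lookup \<mu> (Orig (Free i)) \<noteq> 0}"
    define \<alpha> where "\<alpha> = Poly_Mapping.lookup \<mu> (Orig Bound) - k"
    define \<beta> where "\<beta> = Poly_Mapping.lookup \<mu> Homog - k"
    have \<mu>: "Poly_Mapping.lookup \<mu> (Orig Bound) = k + \<alpha>" "Poly_Mapping.lookup \<mu> Homog = k + \<beta>"
      using int by (simp_all add: \<alpha>_def \<beta>_def)
    have S: "S \<subseteq> {1..n}"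
    proof
      fix i assume "i \<in> S"
      with int(1)[rule_format, of i] show "i \<in> {1..n}" by (cases "i \<in> {1..n}") (auto simp: S_def)
    qed
    have z: "Poly_Mapping.lookup \<mu> (Orig (Free i)) = of_bool (i \<in> S)" for i
      using int(1)[rule_format, of i] by (cases "i \<in> {1..n}") (auto simp: S_def)
    have "(\<Sum>i\<in>{1..n}. of_bool (i \<in> S)) = card S"
      using S by (simp add: of_bool_def Int_absorb1 flip: sum.inter_restrict)
    then have N: "\<alpha> + \<beta> + 2 + card S = 2 * n"
      using deg unfolding monom_degree_L_vars[OF keys] \<mu> z by linarith
    define l where "l = (\<lambda>v. case v of
        Orig Bound \<Rightarrow> real (\<alpha> + \<beta> + 2) * (real (k + \<alpha> + 1) / real (Suc \<alpha>))
      | Orig (Free i) \<Rightarrow> of_bool (i \<in> {1..n} - S)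
      | Homog \<Rightarrow> real (\<alpha> + \<beta> + 2) * (real (k + \<beta> + 1) / real (Suc \<beta>)))"
    have scale: "N * (c * X / a + d * Y / b) = N * (c / a) * X + N * (d / b) * Y" for N a b c d X Y :: real
      by (simp add: algebra_simps)
    show ?thesis
    proof (intro exI[of _ l] allI impI)
      fix \<xi> assume "(\<Sum>v\<in>L_vars n. l v * \<xi> v) = 0"
      moreover have "(\<Sum>i\<in>{1..n}. of_bool (i \<in> {1..n} - S) * \<xi> (Orig (Free i))) = (\<Sum>i\<in>{1..n} - S. \<xi> (Orig (Free i)))"
        by (rule sum.mono_neutral_cong_right) auto
      ultimately have hyp: "real (\<alpha> + \<beta> + 2) * (real (k + \<alpha> + 1) * \<xi> (Orig Bound) / real (Suc \<alpha>)
        + real (k + \<beta> + 1) * \<xi> Homog / real (Suc \<beta>)) + (\<Sum>i\<in>{1..n} - S. \<xi> (Orig (Free i))) = 0"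
        unfolding sum_L_vars scale by (simp only: l_def hvar.case L_colour.case)
      show "hessian_form (L_vars n) (L_poly n k) \<mu> \<xi> \<le> 0"
        by (rule hessian_form_L_poly_nonpos_interior[OF n good S N \<mu> z deg hyp])
    qed
  qed
qed

theorem theorem4p3:
  fixes n :: nat
  shows "pre_lorentzian (L_graph n)"
proof -
  \<comment> \<open>For \<open>n = 0\<close> the polynomial is \<open>x + y\<close> and there is no Hessian to test, provided that the degree
    stays below \<open>2\<close>; this is why \<open>k = 0\<close> is chosen there.\<close>
  obtain k where k: "n > 0 \<Longrightarrow> perturbed_forms_nonpos n k" and k0: "n = 0 \<Longrightarrow> k = 0"
    using ex_perturbed_forms_nonpos[of n] by (cases "n = 0") auto
  have "lorentzian (L_vars n) (L_poly n k)"
  proof (rule lorentzianI[of _ _ "max 1 (2 * n) + 2 * k"])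
    show "homogeneous (max 1 (2 * n) + 2 * k) (L_poly n k)"
      by (simp add: homogeneous_def keys_L_poly L_exponents_def)
    fix \<mu> assume \<mu>: "monom_degree \<mu> + 2 = max 1 (2 * n) + 2 * k" "Poly_Mapping.keys \<mu> \<subseteq> L_vars n"
    then have n: "n > 0" using k0 by (cases "n = 0") auto
    then have "monom_degree \<mu> + 2 = 2 * n + 2 * k" using \<mu>(1) by simp
    with n show "\<exists>l. \<forall>\<xi>. (\<Sum>v\<in>L_vars n. l v * \<xi> v) = 0 \<longrightarrow> hessian_form (L_vars n) (L_poly n k) \<mu> \<xi> \<le> 0"
      using k \<mu>(2) by (intro hessian_form_L_poly_nonpos)
  qed (simp_all add: keys_L_poly keys_subset_L_vars lookup_L_poly M_convex_support_L_poly)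
  then show ?thesis
    unfolding pre_lorentzian_def L_vars_eq using is_partitioned_graph_L_graph
    by (auto simp: L_poly_def L_graph_def)
qed

end
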